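(* Suppose $X$ is a polyhedron and $\Lambda_X(\mathcal{A})$ is nonempty. Then $\Lambda_X^\star(\mathcal{A})$ is finite and \[C_X(\mathcal{A})=\sum_{\lambda\in\Lambda_X^\star(\mathcal{A})}C_X(\mathcal{A},\lambda)\quad\text{(Minkowski sum)}.\] Moreover, there is no proper subset $\Lambda\subsetneq\Lambda_X^\star(\mathcal{A})$ for which $C_X(\mathcal{A})=\sum_{\lambda\in\Lambda}C_X(\mathcal{A},\lambda)$.
   Context: $X\subset\mathbb{R}^n$ is a nonempty closed convex set and $\mathcal{A}\subset\mathbb{R}^n$ is a nonempty finite set such that the functions $x\mapsto\exp(\alpha^Tx)$, $\alpha\in\mathcal{A}$, are linearly independent on $X$. $\mathbb{R}^{\mathcal{A}}$ denotes real vectors indexed by $\mathcal{A}$. $\mathcal{A}\nu=\sum_\alpha\alpha\nu_\alpha$. $\sigma_X(y)=\sup\{y^Tx:x\in X\}$. $N_\beta=\{\nu\in\mathbb{R}^{\mathcal{A}}:\nu_\alpha\ge0\ \forall\alpha\neq\beta,\ \sum_\alpha\nu_\alpha=0\}$. A vector $\nu^\star\in N_\beta$ is an $X$-circuit of $\mathcal{A}$ if (1) $\nu^\star\neq0$, (2) $\sigma_X(-\mathcal{A}\nu^\star)<\infty$, and (3) $\nu^\star$ cannot be written as a convex combination of two non-proportional vectors $\nu^{(1)},\nu^{(2)}\in N_\beta$ such that the map $\nu\mapsto\sigma_X(-\mathcal{A}\nu)$ is affine on the segment $[\nu^{(1)},\nu^{(2)}]$. $\Lambda_X(\mathcal{A})$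 is the set of all $X$-circuits $\lambda$ (over all $\beta\in\mathcal{A}$) normalized so that the unique negative entry equals $-1$. The functional form of $\lambda\in\Lambda_X(\mathcal{A})$ is $\phi_\lambda=(\lambda,\sigma_X(-\mathcal{A}\lambda))\in\mathbb{R}^{\mathcal{A}}\times\mathbb{R}$. The circuit graph is $G_X(\mathcal{A})=\operatorname{cone}(\{\phi_\lambda:\lambda\in\Lambda_X(\mathcal{A})\}\cup\{(0,1)\})$. The set of normalized reduced $X$-circuits $\Lambda_X^\star(\mathcal{A})$ consists of those $\lambda\in\Lambda_X(\mathcal{A})$ for which $\{t\phi_\lambda:t\ge0\}$ is an extreme ray of $G_X(\mathcal{A})$. Signomials $f=\sum_\alpha c_\alpha\mathrm{e}^\alpha$, $\mathrm{e}^\alpha(x)=\exp(\alpha^Tx)$, are identified with $c\in\mathbb{R}^{\mathcal{A}}$; $C_X(\mathcal{A},\beta)$ is the set of $c$ with $f$ nonnegative on $X$ and $c_\alpha\ge0$ for $\alpha\ne\beta$, and $C_X(\mathcal{A})=\sum_{\beta\in\mathcal{A}}C_X(\mathcal{A},\beta)$. For $\lambda\in\Lambda_X(\mathcal{A})$ with negative index $\beta$ and $\lambda^+=\{\alpha:\lambda_\alpha>0\}$, the $\lambda$-witnessed AGE cone is $C_X(\mathcal{A},\lambda)=\{c: c_\alpha\ge0\ \forall\alpha\neq\beta,\ \prod_{\alpha\in\lambda^+}(c_\alpha/\lambda_\alpha)^{\lambda_\alpha}\ge -c_\beta\exp(\sigma_X(-\mathcal{A}\lambda))\}$. *)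

theory Defs
  imports "HOL-Analysis.Analysis"
begin

text \<open>Vectors in R^A are functions 'a => real vanishing outside A.
  X is a subset of a Euclidean space 'a (playing the role of R^n).\<close>

definition in_RA :: "'a set \<Rightarrow> ('a \<Rightarrow> real) \<Rightarrow> bool" where
  "in_RA A c \<longleftrightarrow> (\<forall>\<alpha>. \<alpha> \<notin> A \<longrightarrow> c \<alpha> = 0)"

definition supp_fun :: "'a::euclidean_space set \<Rightarrow> 'a \<Rightarrow> ereal" where
  "supp_fun X y = (SUP x\<in>X. ereal (y \<bullet> x))"

definition Amul :: "'a::euclidean_space set \<Rightarrow> ('a \<Rightarrow> real) \<Rightarrow> 'a" where
  "Amul A \<nu> = (\<Sum>\<alpha>\<in>A. \<nu> \<alpha> *\<^sub>R \<alpha>)"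

definition Nbeta :: "'a set \<Rightarrow> 'a \<Rightarrow> ('a \<Rightarrow> real) set" where
  "Nbeta A \<beta> = {\<nu>. in_RA A \<nu> \<and> (\<forall>\<alpha>\<in>A. \<alpha> \<noteq> \<beta> \<longrightarrow> \<nu> \<alpha> \<ge> 0) \<and> (\<Sum>\<alpha>\<in>A. \<nu> \<alpha>) = 0}"

definition proportional :: "('a \<Rightarrow> real) \<Rightarrow> ('a \<Rightarrow> real) \<Rightarrow> bool" where
  "proportional u v \<longleftrightarrow> (\<exists>t::real. u = (\<lambda>\<alpha>. t * v \<alpha>)) \<or> (\<exists>t::real. v = (\<lambda>\<alpha>. t * u \<alpha>))"

definition affine_on_segment ::
  "'a::euclidean_space set \<Rightarrow> 'a set \<Rightarrow> ('a \<Rightarrow> real) \<Rightarrow> ('a \<Rightarrow> real) \<Rightarrow> bool" where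
  "affine_on_segment X A \<nu>1 \<nu>2 \<longleftrightarrow>
     (\<exists>a b :: real. \<forall>t\<in>{0..1}.
        supp_fun X (- Amul A (\<lambda>\<alpha>. (1 - t) * \<nu>1 \<alpha> + t * \<nu>2 \<alpha>)) = ereal (a + b * t))"

definition X_circuit :: "'a::euclidean_space set \<Rightarrow> 'a set \<Rightarrow> 'a \<Rightarrow> ('a \<Rightarrow> real) \<Rightarrow> bool" where
  "X_circuit X A \<beta> \<nu> \<longleftrightarrow>
     \<nu> \<in> Nbeta A \<beta> \<and> \<nu> \<noteq> (\<lambda>_. 0) \<and> supp_fun X (- Amul A \<nu>) < \<infinity> \<and>
     \<not> (\<exists>\<nu>1 \<nu>2 \<theta>. \<nu>1 \<in> Nbeta A \<beta> \<and> \<nu>2 \<in> Nbeta A \<beta> \<and> \<not> proportional \<nu>1 \<nu>2 \<and>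
          \<theta> \<in> {0<..<1::real} \<and> \<nu> = (\<lambda>\<alpha>. \<theta> * \<nu>1 \<alpha> + (1 - \<theta>) * \<nu>2 \<alpha>) \<and>
          affine_on_segment X A \<nu>1 \<nu>2)"

definition Lambda_X :: "'a::euclidean_space set \<Rightarrow> 'a set \<Rightarrow> ('a \<Rightarrow> real) set" where
  "Lambda_X X A = {lam. \<exists>\<beta>\<in>A. X_circuit X A \<beta> lam \<and> lam \<beta> = -1}"

definition funform :: "'a::euclidean_space set \<Rightarrow> 'a set \<Rightarrow> ('a \<Rightarrow> real) \<Rightarrow> ('a \<Rightarrow> real) \<times> real" where
  "funform X A lam = (lam, real_of_ereal (supp_fun X (- Amul A lam)))"

definition cone_hull :: "(('a \<Rightarrow> real) \<times> real) set \<Rightarrow> (('a \<Rightarrow> real) \<times> real) set" where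
  "cone_hull S = {((\<lambda>\<alpha>. \<Sum>s\<in>F. t s * fst s \<alpha>), (\<Sum>s\<in>F. t s * snd s)) | F t.
                   finite F \<and> F \<subseteq> S \<and> (\<forall>s\<in>F. t s \<ge> 0)}"

definition circuit_graph :: "'a::euclidean_space set \<Rightarrow> 'a set \<Rightarrow> (('a \<Rightarrow> real) \<times> real) set" where
  "circuit_graph X A = cone_hull (funform X A ` Lambda_X X A \<union> {((\<lambda>_. 0), 1)})"

definition ray :: "('a \<Rightarrow> real) \<times> real \<Rightarrow> (('a \<Rightarrow> real) \<times> real) set" where
  "ray p = {((\<lambda>\<alpha>. t * fst p \<alpha>), t * snd p) | t. t \<ge> (0::real)}"

definition extreme_ray :: "(('a \<Rightarrow> real) \<times> real) set \<Rightarrow> ('a \<Rightarrow> real) \<times> real \<Rightarrow> bool" where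
  "extreme_ray G p \<longleftrightarrow> p \<noteq> ((\<lambda>_. 0), 0) \<and> p \<in> G \<and>
     (\<forall>x\<in>G. \<forall>y\<in>G. ((\<lambda>\<alpha>. fst x \<alpha> + fst y \<alpha>), snd x + snd y) \<in> ray p \<longrightarrow> x \<in> ray p \<and> y \<in> ray p)"

definition Lambda_X_star :: "'a::euclidean_space set \<Rightarrow> 'a set \<Rightarrow> ('a \<Rightarrow> real) set" where
  "Lambda_X_star X A = {lam\<in>Lambda_X X A. extreme_ray (circuit_graph X A) (funform X A lam)}"

definition signomial :: "'a::euclidean_space set \<Rightarrow> ('a \<Rightarrow> real) \<Rightarrow> 'a \<Rightarrow> real" where
  "signomial A c x = (\<Sum>\<alpha>\<in>A. c \<alpha> * exp (\<alpha> \<bullet> x))"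

definition SAGE_beta :: "'a::euclidean_space set \<Rightarrow> 'a set \<Rightarrow> 'a \<Rightarrow> ('a \<Rightarrow> real) set" where
  "SAGE_beta X A \<beta> = {c. in_RA A c \<and> (\<forall>\<alpha>\<in>A. \<alpha> \<noteq> \<beta> \<longrightarrow> c \<alpha> \<ge> 0) \<and>
                          (\<forall>x\<in>X. signomial A c x \<ge> 0)}"

text \<open>Minkowski sum of a family of subsets of R^A indexed by a finite set I (empty sum = {0}).\<close>
definition msum :: "'i set \<Rightarrow> ('i \<Rightarrow> ('a \<Rightarrow> real) set) \<Rightarrow> ('a \<Rightarrow> real) set" where
  "msum I C = {c. \<exists>cs. (\<forall>i\<in>I. cs i \<in> C i) \<and> c = (\<lambda>\<alpha>. \<Sum>i\<in>I. cs i \<alpha>)}"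

definition SAGE :: "'a::euclidean_space set \<Rightarrow> 'a set \<Rightarrow> ('a \<Rightarrow> real) set" where
  "SAGE X A = msum A (SAGE_beta X A)"

definition neg_idx :: "'a set \<Rightarrow> ('a \<Rightarrow> real) \<Rightarrow> 'a" where
  "neg_idx A lam = (THE \<beta>. \<beta> \<in> A \<and> lam \<beta> < 0)"

definition AGE_lambda :: "'a::euclidean_space set \<Rightarrow> 'a set \<Rightarrow> ('a \<Rightarrow> real) \<Rightarrow> ('a \<Rightarrow> real) set" where
  "AGE_lambda X A lam = {c. in_RA A c \<and> (\<forall>\<alpha>\<in>A. \<alpha> \<noteq> neg_idx A lam \<longrightarrow> c \<alpha> \<ge> 0) \<and>
      (\<Prod>\<alpha>\<in>{\<alpha>\<in>A. lam \<alpha> > 0}. (c \<alpha> / lam \<alpha>) powr (lam \<alpha>))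
        \<ge> - c (neg_idx A lam) * exp (real_of_ereal (supp_fun X (- Amul A lam)))}"

definition exp_lin_indep_on :: "'a::euclidean_space set \<Rightarrow> 'a set \<Rightarrow> bool" where
  "exp_lin_indep_on X A \<longleftrightarrow>
     (\<forall>c. (\<forall>x\<in>X. (\<Sum>\<alpha>\<in>A. c \<alpha> * exp (\<alpha> \<bullet> x)) = 0) \<longrightarrow> (\<forall>\<alpha>\<in>A. c \<alpha> = 0))"

end

theory Submission
  imports Defs "HOL-Library.Function_Algebras"
begin

text \<open>
  For polyhedral \<open>X\<close> the epigraph of \<open>\<nu> \<mapsto> \<sigma>\<^sub>X(- A \<nu>)\<close> over \<open>N\<^sub>\<beta>\<close> is a finitely generated cone
  whose extreme rays are \<open>(0, 1)\<close> or functional forms of circuits, and the circuit graph is the sum of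
  these epigraphs over \<open>\<beta>\<close>. Finitely many points \<open>x\<close> of \<open>X\<close> separate the exponents, because the
  exponentials are linearly independent on \<open>X\<close>. With \<open>y\<^sub>\<alpha> = ln (\<Sum>\<^sub>x e\<^bsup>\<alpha> \<bullet> x\<^esup>)\<close>, strict convexity
  of log-sum-exp makes the functional \<open>(\<nu>, \<tau>) \<mapsto> \<nu> \<bullet> y + \<tau>\<close> positive on the circuit graph away from
  the origin. So this cone is salient, and its finitely many extreme rays generate it.

  By the weighted arithmetic-geometric mean inequality, \<open>e\<^sup>y\<close> is nonnegative on the \<open>\<lambda>\<close>-witnessed
  AGE cone iff \<open>(y, 1)\<close> is nonnegative on the functional form of \<open>\<lambda>\<close>. If \<open>c\<close> is not in the sum over
  the reduced circuits, which is closed, then some \<open>e\<^sup>y\<close> separates it from this sum. Hence \<open>(y, 1)\<close> is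
  nonnegative on the circuit graph, and Farkas' lemma yields \<open>x \<in> X\<close> with
  \<open>(\<alpha> - \<beta>) \<bullet> x \<le> y\<^sub>\<alpha> - y\<^sub>\<beta>\<close> for all \<open>\<alpha>\<close>; at this \<open>x\<close> an AGE signomial with coefficients \<open>c\<close>
  would be negative. Conversely, a reduced circuit is not in the cone generated by the others, so some
  \<open>y\<close> is feasible for the others but not for it.
\<close>

section \<open>Functions as a real vector space\<close>

instantiation "fun" :: (type, real_vector) real_vector
begin

definition scaleR_fun_def: "r *\<^sub>R f = (\<lambda>x. r *\<^sub>R f x)"

instance
  by standard (auto simp: scaleR_fun_def scaleR_add_right scaleR_add_left fun_eq_iff)

end

lemma scaleR_fun_apply [simp]: "(r *\<^sub>R f) x = r *\<^sub>R f x"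
  by (simp add: scaleR_fun_def)

lemma sum_fun_apply: "(\<Sum>i\<in>I. f i) x = (\<Sum>i\<in>I. f i x)"
  by (induction I rule: infinite_finite_induct) auto

section \<open>Finitely generated cones\<close>

lemma convex_cone_sum:
  "convex_cone C \<Longrightarrow> (\<And>i. i \<in> I \<Longrightarrow> x i \<in> C) \<Longrightarrow> (\<Sum>i\<in>I. x i) \<in> C"
  by (induction I rule: infinite_finite_induct) (auto simp: convex_cone_contains_0 convex_cone_add)

lemma convex_cone_linear_vimage:
  "linear f \<Longrightarrow> convex_cone C \<Longrightarrow> convex_cone (f -` C)"
  by (simp add: convex_cone_iff linear_0 linear_add linear_cmul)

lemma convex_cone_linear_nonneg:
  fixes \<phi> :: "'v::real_vector \<Rightarrow> real"
  assumes "linear \<phi>"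
  shows "convex_cone {x. 0 \<le> \<phi> x}"
  using assms by (simp add: convex_cone_iff linear_0 linear_add linear_cmul)

lemma convex_cone_zero_or_linear_pos:
  fixes \<phi> :: "'v::real_vector \<Rightarrow> real"
  assumes "linear \<phi>"
  shows "convex_cone {x. x = 0 \<or> 0 < \<phi> x}"
  using assms by (auto simp: convex_cone_iff linear_0 linear_add linear_cmul add_pos_pos order_le_less)

lemma in_convex_cone_if_in_hull:
  "x \<in> convex_cone hull S \<Longrightarrow> S \<subseteq> C \<Longrightarrow> convex_cone C \<Longrightarrow> x \<in> C"
  by (metis hull_minimal subsetD)

lemma convex_cone_hull_induct [consumes 1, case_names zero generator add scaleR]:
  assumes "x \<in> convex_cone hull S"
    and "P 0"
    and "\<And>s. s \<in> S \<Longrightarrow> P s"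
    and "\<And>x y. x \<in> convex_cone hull S \<Longrightarrow> y \<in> convex_cone hull S \<Longrightarrow> P x \<Longrightarrow> P y \<Longrightarrow> P (x + y)"
    and "\<And>c x. 0 \<le> c \<Longrightarrow> x \<in> convex_cone hull S \<Longrightarrow> P x \<Longrightarrow> P (c *\<^sub>R x)"
  shows "P x"
proof -
  let ?H = "{x \<in> convex_cone hull S. P x}"
  have "convex_cone ?H"
    using assms(2,4,5)
    by (simp add: convex_cone_iff convex_cone_hull_contains_0 convex_cone_hull_add convex_cone_hull_mul)
  moreover have "S \<subseteq> ?H"
    using assms(3) by (auto intro: hull_inc)
  ultimately have "x \<in> ?H"
    by (intro in_convex_cone_if_in_hull[OF assms(1)])
  then show ?thesis by blast
qed

lemma convex_cone_hull_nonneg: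
  fixes \<phi> :: "'v::real_vector \<Rightarrow> real"
  assumes "linear \<phi>" "x \<in> convex_cone hull S" "\<And>s. s \<in> S \<Longrightarrow> 0 \<le> \<phi> s"
  shows "0 \<le> \<phi> x"
  using in_convex_cone_if_in_hull[OF assms(2) _ convex_cone_linear_nonneg[OF assms(1)]] assms(3) by blast

lemma convex_cone_hull_UnE:
  assumes "x \<in> convex_cone hull (S \<union> T)"
  obtains y z where "y \<in> convex_cone hull S" "z \<in> convex_cone hull T" "x = y + z"
  using assms by (auto simp: convex_cone_hull_Un)

lemma convex_cone_hull_singleton: "convex_cone hull {s} = {c *\<^sub>R s | c. 0 \<le> c}"
  by (subst convex_cone_hull_convex_hull) force

lemma convex_cone_hull_insertE:
  assumes "x \<in> convex_cone hull (insert s S)"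
  obtains c y where "0 \<le> c" "y \<in> convex_cone hull S" "x = c *\<^sub>R s + y"
proof -
  have "x \<in> convex_cone hull ({s} \<union> S)" using assms by simp
  then show thesis
    using that by (elim convex_cone_hull_UnE) (auto simp: convex_cone_hull_singleton)
qed

definition finitely_generated_cone :: "'v::real_vector set \<Rightarrow> bool" where
  "finitely_generated_cone C \<longleftrightarrow> (\<exists>S. finite S \<and> C = convex_cone hull S)"

lemma finitely_generated_cone_hull: "finite S \<Longrightarrow> finitely_generated_cone (convex_cone hull S)"
  by (auto simp: finitely_generated_cone_def)

lemma finitely_generated_cone_linear_image:
  "linear f \<Longrightarrow> finitely_generated_cone C \<Longrightarrow> finitely_generated_cone (f ` C)"
  by (metis convex_cone_hull_linear_image finite_imageI finitely_generated_cone_def)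

lemma finitely_generated_cone_UNIV_real: "finitely_generated_cone (UNIV :: real set)"
proof -
  have "max x 0 *\<^sub>R 1 + max (- x) 0 *\<^sub>R - 1 \<in> convex_cone hull {1, - 1}" for x :: real
    by (intro convex_cone_hull_add convex_cone_hull_mul hull_inc) auto
  moreover have "max x 0 *\<^sub>R 1 + max (- x) 0 *\<^sub>R - 1 = x" for x :: real
    by (simp add: max_def)
  ultimately have "convex_cone hull {1, - 1} = (UNIV :: real set)"
    by (metis UNIV_eq_I)
  then show ?thesis
    using finitely_generated_cone_hull[of "{1, - 1 :: real}"] by simp
qed

lemma finitely_generated_cone_Times:
  fixes C :: "'v::real_vector set" and D :: "'w::real_vector set"
  assumes "finitely_generated_cone C" "finitely_generated_cone D"
  shows "finitely_generated_cone (C \<times> D)"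
proof -
  obtain S T where S: "finite S" "C = convex_cone hull S" and T: "finite T" "D = convex_cone hull T"
    using assms by (auto simp: finitely_generated_cone_def)
  let ?l = "\<lambda>v. (v, 0 :: 'w)" and ?r = "\<lambda>w. (0 :: 'v, w)"
  have linear_left: "linear ?l" and linear_right: "linear ?r"
    by (auto intro: linearI)
  have "convex_cone hull (?l ` S \<union> ?r ` T) = (\<Union>x\<in>?l ` C. \<Union>y\<in>?r ` D. {x + y})"
    by (simp only: convex_cone_hull_Un convex_cone_hull_linear_image[OF linear_left]
        convex_cone_hull_linear_image[OF linear_right] S(2) T(2))
  also have "\<dots> = C \<times> D"
    by force
  finally show ?thesis
    using S(1) T(1) by (metis finitely_generated_cone_hull finite_Un finite_imageI)
qed

text \<open>One step of Fourier--Motzkin elimination: every pair of generators on opposite sides of the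
  hyperplane is replaced by the point where the cone they span meets it.\<close>

lemma elimination_combination_in_hull:
  fixes h :: "'v::real_vector \<Rightarrow> real"
  assumes "linear h" "u \<in> convex_cone hull P" "v \<in> convex_cone hull N"
  shows "h u *\<^sub>R v - h v *\<^sub>R u \<in> convex_cone hull ((\<lambda>(p, q). h p *\<^sub>R q - h q *\<^sub>R p) ` (P \<times> N))"
    (is "_ \<in> ?H")
proof -
  have cone: "convex_cone ?H" by (rule convex_cone_convex_cone_hull)
  have generator: "h u *\<^sub>R q - h q *\<^sub>R u \<in> ?H" if q: "q \<in> N" for q
  proof -
    have "linear (\<lambda>u. h u *\<^sub>R q - h q *\<^sub>R u)"
      using assms(1) by (intro linearI) (auto simp: linear_add linear_cmul algebra_simps)
    then have "convex_cone ((\<lambda>u. h u *\<^sub>R q - h q *\<^sub>R u) -` ?H)"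
      using cone by (rule convex_cone_linear_vimage)
    moreover have "P \<subseteq> (\<lambda>u. h u *\<^sub>R q - h q *\<^sub>R u) -` ?H"
      using q by (auto intro!: hull_inc)
    ultimately show ?thesis
      using assms(2) in_convex_cone_if_in_hull by blast
  qed
  have "linear (\<lambda>v. h u *\<^sub>R v - h v *\<^sub>R u)"
    using assms(1) by (intro linearI) (auto simp: linear_add linear_cmul algebra_simps)
  then have "convex_cone ((\<lambda>v. h u *\<^sub>R v - h v *\<^sub>R u) -` ?H)"
    using cone by (rule convex_cone_linear_vimage)
  moreover have "N \<subseteq> (\<lambda>v. h u *\<^sub>R v - h v *\<^sub>R u) -` ?H"
    using generator by auto
  ultimately show ?thesis
    using assms(3) in_convex_cone_if_in_hull by blast
qed

lemma convex_cone_hull_Int_hyperplane_subset: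
  fixes h :: "'v::real_vector \<Rightarrow> real"
  assumes "linear h" "\<And>p. p \<in> P \<Longrightarrow> 0 < h p" "\<And>q. q \<in> N \<Longrightarrow> h q < 0" "\<And>z. z \<in> Z \<Longrightarrow> h z = 0"
    and x: "x \<in> convex_cone hull (P \<union> N \<union> Z)" "h x = 0"
  shows "x \<in> convex_cone hull ((\<lambda>(p, q). h p *\<^sub>R q - h q *\<^sub>R p) ` (P \<times> N) \<union> Z)"
    (is "_ \<in> convex_cone hull (?T \<union> Z)")
proof -
  obtain u v z where u: "u \<in> convex_cone hull P" and v: "v \<in> convex_cone hull N"
    and z: "z \<in> convex_cone hull Z" and x_eq: "x = u + v + z"
    using x(1) by (metis convex_cone_hull_UnE)
  have "h z = 0"
    using z assms(1,4)
    by (induction rule: convex_cone_hull_induct) (auto simp: linear_0 linear_add linear_cmul)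
  then have opposite: "h v = - h u"
    using x(2) by (simp add: x_eq linear_add[OF assms(1)])
  have u_pos: "u = 0 \<or> 0 < h u"
    using in_convex_cone_if_in_hull[OF u _ convex_cone_zero_or_linear_pos[OF assms(1)]] assms(2) by auto
  have v_neg: "v = 0 \<or> h v < 0"
    using assms(3) linear_compose_neg[OF assms(1)]
      in_convex_cone_if_in_hull[OF v _ convex_cone_zero_or_linear_pos[of "\<lambda>x. - h x"]] by auto
  have "u + v \<in> convex_cone hull ?T"
  proof (cases "h u = 0")
    case True
    then show ?thesis
      using u_pos v_neg opposite by (auto simp: convex_cone_hull_contains_0)
  next
    case False
    then have "0 < h u" using u_pos linear_0[OF assms(1)] by auto
    moreover have "h u *\<^sub>R (u + v) \<in> convex_cone hull ?T"
      using elimination_combination_in_hull[OF assms(1) u v] by (simp add: opposite algebra_simps)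
    ultimately show ?thesis
      using convex_cone_hull_mul[of "h u *\<^sub>R (u + v)" ?T "1 / h u"] by simp
  qed
  then show ?thesis
    using z by (auto simp: x_eq convex_cone_hull_Un)
qed

lemma finitely_generated_cone_Int_hyperplane:
  fixes h :: "'v::real_vector \<Rightarrow> real"
  assumes "finitely_generated_cone C" "linear h"
  shows "finitely_generated_cone (C \<inter> {x. h x = 0})"
proof -
  obtain S where S: "finite S" "C = convex_cone hull S"
    using assms(1) by (auto simp: finitely_generated_cone_def)
  define P N Z where "P = {s\<in>S. 0 < h s}" and "N = {s\<in>S. h s < 0}" and "Z = {s\<in>S. h s = 0}"
  define T where "T = (\<lambda>(p, q). h p *\<^sub>R q - h q *\<^sub>R p) ` (P \<times> N)"
  have "C \<inter> {x. h x = 0} = convex_cone hull (T \<union> Z)"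
  proof
    have S_split: "P \<union> N \<union> Z = S" by (auto simp: P_def N_def Z_def)
    show "C \<inter> {x. h x = 0} \<subseteq> convex_cone hull (T \<union> Z)"
    proof
      fix x assume "x \<in> C \<inter> {x. h x = 0}"
      then have "x \<in> convex_cone hull (P \<union> N \<union> Z)" "h x = 0"
        by (simp_all add: S_split S(2))
      then show "x \<in> convex_cone hull (T \<union> Z)"
        unfolding T_def
        by (intro convex_cone_hull_Int_hyperplane_subset assms(2)) (auto simp: P_def N_def Z_def)
    qed
    have "h p *\<^sub>R q + (- h q) *\<^sub>R p \<in> C" if "p \<in> P" "q \<in> N" for p q
      unfolding S(2) using that
      by (intro convex_cone_hull_add convex_cone_hull_mul hull_inc) (auto simp: P_def N_def)
    then have "T \<union> Z \<subseteq> C \<inter> {x. h x = 0}"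
      using assms(2) by (auto simp: T_def Z_def S(2) linear_diff linear_cmul intro: hull_inc)
    moreover have "convex_cone (C \<inter> {x. h x = 0})"
      using assms(2) convex_cone_convex_cone_hull[of S]
      by (simp add: S(2) convex_cone_iff linear_0 linear_add linear_cmul)
    ultimately show "convex_cone hull (T \<union> Z) \<subseteq> C \<inter> {x. h x = 0}"
      by (rule hull_minimal)
  qed
  moreover have "finite (T \<union> Z)"
    using S(1) by (simp add: T_def P_def N_def Z_def)
  ultimately show ?thesis
    by (simp add: finitely_generated_cone_hull)
qed

lemma finitely_generated_cone_Int_kernel:
  fixes F :: "'v::real_vector \<Rightarrow> 'w::euclidean_space"
  assumes "finitely_generated_cone C" "linear F"
  shows "finitely_generated_cone (C \<inter> {x. F x = 0})"
proof -
  have "finitely_generated_cone (C \<inter> {x. \<forall>b\<in>B. F x \<bullet> b = 0})" if "finite B" for B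
    using that
  proof (induction B rule: finite_induct)
    case (insert b B)
    have "linear (\<lambda>x. F x \<bullet> b)"
      using assms(2) by (intro linearI) (auto simp: linear_add linear_cmul inner_add_left)
    from finitely_generated_cone_Int_hyperplane[OF insert.IH this] show ?case
      by (simp add: Int_assoc Collect_conj_eq[symmetric] conj_commute)
  qed (use assms(1) in simp)
  from this[OF finite_Basis] show ?thesis
    by (simp add: euclidean_all_zero_iff)
qed

lemma finitely_generated_cone_linear_vimage:
  fixes F :: "'v::real_vector \<Rightarrow> 'w::euclidean_space"
  assumes "finitely_generated_cone C" "finitely_generated_cone D" "linear F"
  shows "finitely_generated_cone (C \<inter> F -` D)"
proof -
  have "linear (\<lambda>z. F (fst z) - snd z)"
    using assms(3) by (intro linearI) (auto simp: linear_add linear_cmul algebra_simps)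
  then have "finitely_generated_cone (fst ` (C \<times> D \<inter> {z. F (fst z) - snd z = 0}))"
    using assms(1,2)
    by (intro finitely_generated_cone_linear_image linear_fst finitely_generated_cone_Int_kernel
        finitely_generated_cone_Times)
  also have "fst ` (C \<times> D \<inter> {z. F (fst z) - snd z = 0}) = C \<inter> F -` D"
    by (force simp: image_iff)
  finally show ?thesis .
qed

section \<open>Farkas' lemma\<close>

lemma negative_perturbation:
  fixes a b :: real
  assumes "a < 0"
  obtains \<epsilon> where "0 < \<epsilon>" "a + \<epsilon> * b < 0"
proof
  show pos: "0 < - a / (\<bar>b\<bar> + 1)"
    using assms by (simp add: divide_neg_pos)
  have "- a / (\<bar>b\<bar> + 1) * b < - a / (\<bar>b\<bar> + 1) * (\<bar>b\<bar> + 1)"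
    using pos by (intro mult_strict_left_mono) auto
  also have "\<dots> = - a"
    by simp
  finally show "a + - a / (\<bar>b\<bar> + 1) * b < 0" by simp
qed

definition kernel_projection :: "('v::real_vector \<Rightarrow> real) \<Rightarrow> 'v \<Rightarrow> 'v \<Rightarrow> 'v" where
  "kernel_projection \<phi> k x = x - (\<phi> x / \<phi> k) *\<^sub>R k"

lemma linear_kernel_projection: "linear \<phi> \<Longrightarrow> linear (kernel_projection \<phi> k)"
  by (intro linearI)
    (auto simp: kernel_projection_def linear_add linear_cmul add_divide_distrib algebra_simps)

lemma kernel_projection_not_in_hull:
  assumes \<phi>: "linear \<phi>" "\<And>s. s \<in> S \<Longrightarrow> 0 \<le> \<phi> s" "\<phi> p < 0" "\<phi> k < 0"
    and p: "p \<notin> convex_cone hull (insert k S)"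
  shows "kernel_projection \<phi> k p \<notin> convex_cone hull (kernel_projection \<phi> k ` S)"
proof
  assume "kernel_projection \<phi> k p \<in> convex_cone hull (kernel_projection \<phi> k ` S)"
  then obtain x where x: "x \<in> convex_cone hull S" "kernel_projection \<phi> k p = kernel_projection \<phi> k x"
    by (auto simp: convex_cone_hull_linear_image[OF linear_kernel_projection[OF \<phi>(1)]])
  have "0 \<le> \<phi> x"
    using \<phi>(2) by (rule convex_cone_hull_nonneg[OF \<phi>(1) x(1)])
  then have "0 \<le> (\<phi> p - \<phi> x) / \<phi> k"
    using \<phi>(3,4) by (intro divide_nonpos_neg) auto
  moreover have "x \<in> convex_cone hull (insert k S)"
    using x(1) hull_mono[of S "insert k S" convex_cone] by blast
  ultimately have "((\<phi> p - \<phi> x) / \<phi> k) *\<^sub>R k + x \<in> convex_cone hull (insert k S)"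
    by (intro convex_cone_hull_add convex_cone_hull_mul) (auto simp: hull_inc)
  also have "((\<phi> p - \<phi> x) / \<phi> k) *\<^sub>R k + x = p"
    using x(2) by (simp add: kernel_projection_def diff_divide_distrib algebra_simps)
  finally show False using p by simp
qed

text \<open>If a functional \<open>\<phi>\<close> separating \<open>p\<close> from the first generators is negative on the last one,
  project onto the kernel of \<open>\<phi>\<close> along that generator and separate there.\<close>

lemma convex_cone_hull_separation:
  fixes p :: "'v::real_vector"
  assumes "finite S" "p \<notin> convex_cone hull S"
  obtains \<phi> :: "'v \<Rightarrow> real" where "linear \<phi>" "\<And>s. s \<in> S \<Longrightarrow> 0 \<le> \<phi> s" "\<phi> p < 0"
proof -
  have "\<exists>\<phi> :: 'v \<Rightarrow> real. linear \<phi> \<and> (\<forall>i\<in>I. 0 \<le> \<phi> (v i)) \<and> \<phi> p < 0"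
    if "finite I" "p \<notin> convex_cone hull (v ` I)" for I :: "'v set" and v :: "'v \<Rightarrow> 'v" and p
    using that
  proof (induction I arbitrary: v p rule: finite_induct)
    case empty
    then obtain \<phi> :: "'v \<Rightarrow> real" where "linear \<phi>" "\<phi> p = -1"
      using linear_independent_extend[of "{p}" "\<lambda>_. -1 :: real"] by auto
    then show ?case by force
  next
    case (insert k I)
    have "p \<notin> convex_cone hull (v ` I)"
      using insert.prems hull_mono[of "v ` I" "v ` insert k I" convex_cone] by blast
    then obtain \<phi> :: "'v \<Rightarrow> real" where \<phi>: "linear \<phi>" "\<And>i. i \<in> I \<Longrightarrow> 0 \<le> \<phi> (v i)" "\<phi> p < 0"
      using insert.IH by blast
    show ?case
    proof (cases "0 \<le> \<phi> (v k)")
      case True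
      then show ?thesis using \<phi> by blast
    next
      case False
      let ?\<pi> = "kernel_projection \<phi> (v k)"
      have "?\<pi> p \<notin> convex_cone hull (?\<pi> ` v ` I)"
        using \<phi> False insert.prems by (intro kernel_projection_not_in_hull) auto
      then obtain \<psi> :: "'v \<Rightarrow> real" where \<psi>: "linear \<psi>" "\<And>i. i \<in> I \<Longrightarrow> 0 \<le> \<psi> (?\<pi> (v i))" "\<psi> (?\<pi> p) < 0"
        using insert.IH[of "?\<pi> p" "?\<pi> \<circ> v"] by (auto simp: image_comp)
      have "?\<pi> (v k) = 0" using False by (simp add: kernel_projection_def)
      then show ?thesis
        using \<psi> linear_compose[OF linear_kernel_projection[OF \<phi>(1)] \<psi>(1), of "v k"]
        by (intro exI[of _ "\<psi> \<circ> ?\<pi>"]) (auto simp: o_def linear_0)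
    qed
  qed
  from this[OF assms(1), of p id] assms(2) show thesis
    using that by auto
qed

lemma convex_cone_hull_separation_normalized:
  fixes p e :: "'v::real_vector" and \<psi> :: "'v \<Rightarrow> real"
  assumes "finite S" "p \<notin> convex_cone hull S" "e \<in> S"
    and \<psi>: "linear \<psi>" "\<And>s. s \<in> S \<Longrightarrow> 0 \<le> \<psi> s" "0 < \<psi> e"
  obtains \<phi> :: "'v \<Rightarrow> real" where "linear \<phi>" "\<And>s. s \<in> S \<Longrightarrow> 0 \<le> \<phi> s" "\<phi> p < 0" "\<phi> e = 1"
proof -
  obtain \<phi> :: "'v \<Rightarrow> real" where \<phi>: "linear \<phi>" "\<And>s. s \<in> S \<Longrightarrow> 0 \<le> \<phi> s" "\<phi> p < 0"
    using convex_cone_hull_separation[OF assms(1,2)] by blast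
  obtain \<epsilon> where \<epsilon>: "0 < \<epsilon>" "\<phi> p + \<epsilon> * \<psi> p < 0"
    using negative_perturbation[OF \<phi>(3)] by blast
  define r where "r = \<phi> e + \<epsilon> * \<psi> e"
  have r: "0 < r"
    using \<phi>(2)[OF assms(3)] \<psi>(3) \<epsilon>(1) by (simp add: r_def add_nonneg_pos)
  show thesis
  proof (rule that[of "\<lambda>x. (\<phi> x + \<epsilon> * \<psi> x) / r"])
    show "linear (\<lambda>x. (\<phi> x + \<epsilon> * \<psi> x) / r)"
      using \<phi>(1) \<psi>(1)
      by (intro linearI) (auto simp: linear_add linear_cmul add_divide_distrib algebra_simps)
  qed (use \<phi>(2) \<psi>(2) \<epsilon> r in \<open>auto simp: r_def divide_neg_pos\<close>)
qed

section \<open>Extreme rays of salient cones\<close>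

definition salient :: "'v::real_vector set \<Rightarrow> bool" where
  "salient C \<longleftrightarrow> (\<forall>x\<in>C. - x \<in> C \<longrightarrow> x = 0)"

lemma salient_if_linear_pos:
  fixes \<phi> :: "'v::real_vector \<Rightarrow> real"
  assumes "linear \<phi>" "\<And>x. x \<in> C \<Longrightarrow> x = 0 \<or> 0 < \<phi> x"
  shows "salient C"
  unfolding salient_def using assms(2) linear_neg[OF assms(1)]
  by (metis neg_0_less_iff_less neg_equal_0_iff_equal order_less_asym)

lemma cone_hull_iff: "p \<in> cone_hull S \<longleftrightarrow>
    (\<exists>F t. finite F \<and> F \<subseteq> S \<and> (\<forall>s\<in>F. 0 \<le> t s) \<and> p = (\<Sum>s\<in>F. t s *\<^sub>R s))"
  by (simp add: cone_hull_def prod_eq_iff fun_eq_iff fst_sum snd_sum sum_fun_apply) blast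

lemma convex_cone_cone_hull: "convex_cone (cone_hull S)"
  unfolding convex_cone_iff
proof (intro conjI ballI allI impI)
  show "0 \<in> cone_hull S"
    unfolding cone_hull_iff by (intro exI[of _ "{}"]) simp
  show "x + y \<in> cone_hull S" if summands: "x \<in> cone_hull S" "y \<in> cone_hull S" for x y
  proof -
    obtain F t G u where F: "finite F" "F \<subseteq> S" "\<forall>s\<in>F. 0 \<le> t s" "x = (\<Sum>s\<in>F. t s *\<^sub>R s)"
      and G: "finite G" "G \<subseteq> S" "\<forall>s\<in>G. 0 \<le> u s" "y = (\<Sum>s\<in>G. u s *\<^sub>R s)"
      using summands unfolding cone_hull_iff by blast
    define t' u' where "t' s = (if s \<in> F then t s else 0)" and "u' s = (if s \<in> G then u s else 0)" for s
    have "x = (\<Sum>s\<in>F \<union> G. t' s *\<^sub>R s)" "y = (\<Sum>s\<in>F \<union> G. u' s *\<^sub>R s)"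
      unfolding F(4) G(4) using F(1) G(1)
      by (intro sum.mono_neutral_cong_left; simp add: t'_def u'_def)+
    then have "x + y = (\<Sum>s\<in>F \<union> G. (t' s + u' s) *\<^sub>R s)"
      by (simp add: scaleR_add_left sum.distrib)
    then show ?thesis
      unfolding cone_hull_iff using F G
      by (intro exI[of _ "F \<union> G"] exI[of _ "\<lambda>s. t' s + u' s"]) (auto simp: t'_def u'_def)
  qed
  show "c *\<^sub>R x \<in> cone_hull S" if x: "x \<in> cone_hull S" and c: "0 \<le> c" for x c
  proof -
    obtain F t where "finite F" "F \<subseteq> S" "\<forall>s\<in>F. 0 \<le> t s" "x = (\<Sum>s\<in>F. t s *\<^sub>R s)"
      using x unfolding cone_hull_iff by blast
    then show ?thesis
      unfolding cone_hull_iff using c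
      by (intro exI[of _ F] exI[of _ "\<lambda>s. c * t s"]) (auto simp: scaleR_sum_right)
  qed
qed

lemma cone_hull_eq: "cone_hull S = convex_cone hull S"
proof
  have "(\<Sum>s\<in>F. t s *\<^sub>R s) \<in> convex_cone hull S" if "F \<subseteq> S" "\<forall>s\<in>F. 0 \<le> t s" for F t
    using that by (intro convex_cone_sum convex_cone_convex_cone_hull convex_cone_hull_mul hull_inc) auto
  then show "cone_hull S \<subseteq> convex_cone hull S"
    by (auto simp: cone_hull_iff)
  have "s \<in> cone_hull S" if "s \<in> S" for s
    unfolding cone_hull_iff using that by (intro exI[of _ "{s}"] exI[of _ "\<lambda>_. 1"]) simp
  then show "convex_cone hull S \<subseteq> cone_hull S"
    by (intro hull_minimal convex_cone_cone_hull) auto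
qed

lemma ray_eq: "ray p = {t *\<^sub>R p | t. 0 \<le> t}"
  by (auto simp: ray_def scaleR_prod_def scaleR_fun_def)

lemma ray_self: "p \<in> ray p"
  by (auto simp: ray_eq intro: exI[of _ 1])

lemma ray_scaleR:
  assumes "0 < c"
  shows "ray (c *\<^sub>R p) = ray p"
proof
  show "ray (c *\<^sub>R p) \<subseteq> ray p"
    using assms by (force simp: ray_eq)
  show "ray p \<subseteq> ray (c *\<^sub>R p)"
  proof
    fix x assume "x \<in> ray p"
    then obtain t where "x = t *\<^sub>R p" "0 \<le> t" by (auto simp: ray_eq)
    then have "x = (t / c) *\<^sub>R (c *\<^sub>R p)" "0 \<le> t / c" using assms by auto
    then show "x \<in> ray (c *\<^sub>R p)" unfolding ray_eq by blast
  qed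
qed

lemma scaleR_in_rayD:
  assumes "0 < c" "c *\<^sub>R x \<in> ray p"
  shows "x \<in> ray p"
proof -
  obtain t where t: "0 \<le> t" "c *\<^sub>R x = t *\<^sub>R p"
    using assms(2) by (auto simp: ray_eq)
  have "x = (1 / c) *\<^sub>R (c *\<^sub>R x)" using assms(1) by simp
  then have "x = (t / c) *\<^sub>R p" by (simp add: t(2))
  then show ?thesis using t(1) assms(1) by (auto simp: ray_eq)
qed

lemma extreme_ray_iff:
  "extreme_ray G p \<longleftrightarrow> p \<noteq> 0 \<and> p \<in> G \<and> (\<forall>x\<in>G. \<forall>y\<in>G. x + y \<in> ray p \<longrightarrow> x \<in> ray p \<and> y \<in> ray p)"
  by (simp add: extreme_ray_def zero_prod_def plus_prod_def zero_fun_def plus_fun_def)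

lemma extreme_ray_scaleR:
  assumes "extreme_ray G p" "0 < c" "convex_cone G"
  shows "extreme_ray G (c *\<^sub>R p)"
  using assms by (auto simp: extreme_ray_iff ray_scaleR convex_cone_scaleR)

lemma extreme_ray_subset:
  "extreme_ray G p \<Longrightarrow> H \<subseteq> G \<Longrightarrow> p \<in> H \<Longrightarrow> extreme_ray H p"
  unfolding extreme_ray_iff by blast

lemma extreme_ray_multiple_of_generator:
  assumes "extreme_ray (convex_cone hull S) p"
  obtains s c where "s \<in> S" "0 < c" "s = c *\<^sub>R p"
proof -
  have "x = 0 \<or> (\<exists>s\<in>S. \<exists>c>0. s = c *\<^sub>R p)" if "x \<in> convex_cone hull S" "x \<in> ray p" for x
    using that
  proof (induction rule: convex_cone_hull_induct)
    case (generator s)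
    then show ?case by (fastforce simp: ray_eq order_le_less)
  next
    case (add x y)
    then show ?case using assms unfolding extreme_ray_iff by (metis add_0)
  next
    case (scaleR c x)
    then show ?case using scaleR_in_rayD[of c x p] by (fastforce simp: order_le_less)
  qed simp
  moreover have "p \<noteq> 0" "p \<in> convex_cone hull S"
    using assms by (auto simp: extreme_ray_iff)
  ultimately show thesis
    using that ray_self by blast
qed

lemma finite_extreme_rays:
  assumes "finitely_generated_cone C"
  shows "finite (ray ` {p. extreme_ray C p})"
proof -
  obtain S where S: "finite S" "C = convex_cone hull S"
    using assms by (auto simp: finitely_generated_cone_def)
  have "ray p \<in> ray ` S" if "extreme_ray C p" for p
    using that extreme_ray_multiple_of_generator ray_scaleR unfolding S(2) by (metis imageI)
  then show ?thesis
    using S(1) by (auto intro: finite_subset[of _ "ray ` S"])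
qed

lemma minimal_cone_generators:
  assumes "finitely_generated_cone C"
  obtains S where "finite S" "C = convex_cone hull S" "\<And>s. s \<in> S \<Longrightarrow> s \<notin> convex_cone hull (S - {s})"
proof -
  let ?generates = "\<lambda>S. finite S \<and> C = convex_cone hull S"
  obtain S' where "?generates S'"
    using assms by (auto simp: finitely_generated_cone_def)
  from ex_has_least_nat[of ?generates, OF this] obtain S where S: "finite S" "C = convex_cone hull S"
    and minimal: "\<And>T. ?generates T \<Longrightarrow> card S \<le> card T"
    by blast
  have "s \<notin> convex_cone hull (S - {s})" if "s \<in> S" for s
  proof
    assume "s \<in> convex_cone hull (S - {s})"
    then have "convex_cone hull (S - {s}) = C"
      unfolding S(2) using hull_redundant[of s convex_cone "S - {s}"] that by (simp add: insert_absorb)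
    then show False
      using minimal[of "S - {s}"] S(1) that by (metis card_Diff1_less finite_Diff linorder_not_less)
  qed
  then show thesis using that S by blast
qed

lemma extreme_ray_if_irredundant:
  assumes "salient (convex_cone hull (insert s S))" "s \<notin> convex_cone hull S"
  shows "extreme_ray (convex_cone hull (insert s S)) s" (is "extreme_ray ?C s")
  unfolding extreme_ray_iff
proof (intro conjI ballI impI)
  have hull_S_subset: "convex_cone hull S \<subseteq> ?C" by (intro hull_mono) auto
  show "s \<noteq> 0" using assms(2) convex_cone_hull_contains_0 by metis
  show s_in_cone: "s \<in> ?C" by (simp add: hull_inc)
  fix x y assume "x \<in> ?C" "y \<in> ?C" "x + y \<in> ray s"
  then obtain a x' b y' k where x: "0 \<le> a" "x' \<in> convex_cone hull S" "x = a *\<^sub>R s + x'"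
    and y: "0 \<le> b" "y' \<in> convex_cone hull S" "y = b *\<^sub>R s + y'" and k: "0 \<le> k" "x + y = k *\<^sub>R s"
    by (auto simp: ray_eq elim!: convex_cone_hull_insertE)
  have rest: "x' + y' = (k - a - b) *\<^sub>R s"
    using k(2) by (simp add: x(3) y(3) algebra_simps)
  have "k - a - b \<le> 0"
  proof (rule ccontr)
    assume "\<not> k - a - b \<le> 0"
    then have "s = (1 / (k - a - b)) *\<^sub>R (x' + y')" "0 \<le> 1 / (k - a - b)"
      unfolding rest by auto
    then show False
      using assms(2) convex_cone_hull_add[OF x(2) y(2)] convex_cone_hull_mul by metis
  qed
  then have slack: "(a + b - k) *\<^sub>R s \<in> ?C"
    using s_in_cone by (intro convex_cone_hull_mul) auto
  have parts_in_cone: "x' \<in> ?C" "y' \<in> ?C"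
    using x(2) y(2) hull_S_subset by auto
  have "y' + (a + b - k) *\<^sub>R s = - x'" "x' + (a + b - k) *\<^sub>R s = - y'"
    using rest by (simp_all add: algebra_simps eq_neg_iff_add_eq_0)
  then have "- x' \<in> ?C" "- y' \<in> ?C"
    using convex_cone_hull_add[OF parts_in_cone(2) slack] convex_cone_hull_add[OF parts_in_cone(1) slack]
    by simp_all
  then have "x' = 0" "y' = 0"
    using assms(1) parts_in_cone unfolding salient_def by blast+
  then show "x \<in> ray s" "y \<in> ray s"
    using x y by (auto simp: ray_eq)
qed

lemma convex_cone_hull_extreme_rays:
  assumes "finitely_generated_cone C" "salient C"
  shows "convex_cone hull {p. extreme_ray C p} = C"
proof -
  obtain S where S: "C = convex_cone hull S" "\<And>s. s \<in> S \<Longrightarrow> s \<notin> convex_cone hull (S - {s})"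
    using minimal_cone_generators[OF assms(1)] by metis
  have "extreme_ray C s" if s: "s \<in> S" for s
    using extreme_ray_if_irredundant[of s "S - {s}"] S(2)[OF s] assms(2) s by (simp add: S(1) insert_absorb)
  then have "S \<subseteq> {p. extreme_ray C p}" by blast
  then have "C \<subseteq> convex_cone hull {p. extreme_ray C p}"
    unfolding S(1) by (rule hull_mono)
  moreover have "convex_cone hull {p. extreme_ray C p} \<subseteq> C"
    by (rule hull_minimal) (auto simp: S(1) extreme_ray_iff convex_cone_convex_cone_hull)
  ultimately show ?thesis by blast
qed

section \<open>Closed convex cones of real vectors indexed by a finite set\<close>

definition inner_on :: "'a set \<Rightarrow> ('a \<Rightarrow> real) \<Rightarrow> ('a \<Rightarrow> real) \<Rightarrow> real" where
  "inner_on A u v = (\<Sum>\<alpha>\<in>A. u \<alpha> * v \<alpha>)"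

lemma inner_on_commute: "inner_on A u v = inner_on A v u"
  by (simp add: inner_on_def mult.commute)

lemma linear_inner_on: "linear (\<lambda>u. inner_on A u v)"
  by (intro linearI) (simp_all add: inner_on_def algebra_simps sum.distrib sum_distrib_left)

lemmas inner_on_add_left = linear_add[OF linear_inner_on]
  and inner_on_diff_left = linear_diff[OF linear_inner_on]
  and inner_on_minus_left = linear_neg[OF linear_inner_on]
  and inner_on_scaleR_left = linear_cmul[OF linear_inner_on]
  and inner_on_sum_left = linear_sum[OF linear_inner_on]
  and inner_on_zero_left = linear_0[OF linear_inner_on]

lemma inner_on_add_right: "inner_on A u (v + w) = inner_on A u v + inner_on A u w"
  by (simp add: inner_on_commute[of A u] inner_on_add_left)

lemma inner_on_minus_right: "inner_on A u (- v) = - inner_on A u v"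
  by (simp add: inner_on_commute[of A u] inner_on_minus_left)

lemma inner_on_scaleR_right: "inner_on A u (k *\<^sub>R v) = k * inner_on A u v"
  by (simp add: inner_on_commute[of A u] inner_on_scaleR_left)

lemma continuous_on_apply: "continuous_on S (\<lambda>f :: 'i \<Rightarrow> 'b::topological_space. f i)"
  by (rule continuous_on_subset[OF continuous_on_product_coordinates subset_UNIV])

lemma continuous_on_inner_on [continuous_intros]:
  "continuous_on S f \<Longrightarrow> continuous_on S (\<lambda>x. inner_on A (f x) v)"
  unfolding inner_on_def
  by (intro continuous_intros) (rule continuous_on_product_then_coordinatewise)

lemma in_RA_eqI: "in_RA A c \<Longrightarrow> in_RA A d \<Longrightarrow> (\<And>\<alpha>. \<alpha> \<in> A \<Longrightarrow> c \<alpha> = d \<alpha>) \<Longrightarrow> c = d"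
  by (rule ext) (metis in_RA_def)

lemma compact_imp_closed_fun:
  fixes K :: "('i \<Rightarrow> 'b::metric_space) set"
  assumes "compact K"
  shows "closed K"
proof -
  have "Hausdorff_space (euclidean :: ('i \<Rightarrow> 'b) topology)"
    unfolding euclidean_product_topology[symmetric]
    by (simp add: Hausdorff_space_product_topology)
  then show ?thesis
    using compactin_imp_closedin assms by fastforce
qed

lemma compact_Collect_coordinates:
  fixes K :: "'i \<Rightarrow> 'b::topological_space set"
  assumes "\<And>i. compact (K i)"
  shows "compact {f. \<forall>i. f i \<in> K i}"
proof -
  have "compactin (product_topology (\<lambda>_. euclidean) UNIV) (PiE UNIV K)"
    using assms by (simp add: compactin_PiE)
  moreover have "PiE UNIV K = {f. \<forall>i. f i \<in> K i}" by auto
  ultimately show ?thesis by (simp add: euclidean_product_topology)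
qed

lemma compact_in_RA:
  assumes "closed C" "\<And>c. c \<in> C \<Longrightarrow> in_RA A c" "\<And>c \<alpha>. c \<in> C \<Longrightarrow> \<alpha> \<in> A \<Longrightarrow> \<bar>c \<alpha>\<bar> \<le> b \<alpha>"
  shows "compact C"
proof -
  let ?box = "{c. \<forall>\<alpha>. c \<alpha> \<in> (if \<alpha> \<in> A then {- b \<alpha>..b \<alpha>} else {0})}"
  have "c \<in> ?box" if "c \<in> C" for c
    using assms(2)[OF that] assms(3)[OF that] by (auto simp: in_RA_def abs_le_iff minus_le_iff)
  then have "C = ?box \<inter> C" by blast
  moreover have "compact (?box \<inter> C)"
    using assms(1) by (intro compact_Int_closed compact_Collect_coordinates) auto
  ultimately show ?thesis by simp
qed

lemma compact_sum_abs_slice: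
  assumes "finite A" "closed C" "\<And>c. c \<in> C \<Longrightarrow> in_RA A c"
  shows "compact {c \<in> C. (\<Sum>\<alpha>\<in>A. \<bar>c \<alpha>\<bar>) = b}"
proof -
  have "closed {c :: 'a \<Rightarrow> real. (\<Sum>\<alpha>\<in>A. \<bar>c \<alpha>\<bar>) = b}"
    by (intro closed_Collect_eq continuous_intros continuous_on_apply)
  then have "closed {c \<in> C. (\<Sum>\<alpha>\<in>A. \<bar>c \<alpha>\<bar>) = b}"
    using assms(2) by (simp add: Collect_conj_eq closed_Int)
  moreover have "\<bar>c \<alpha>\<bar> \<le> (\<Sum>\<alpha>\<in>A. \<bar>c \<alpha>\<bar>)" if "\<alpha> \<in> A" for c :: "'a \<Rightarrow> real" and \<alpha>
    using assms(1) that by (intro member_le_sum) auto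
  ultimately show ?thesis
    using assms(3) by (intro compact_in_RA[of _ A "\<lambda>_. b"]) auto
qed

lemma positive_functional_coercive:
  assumes "finite A" "closed C" "convex_cone C" and RA: "\<And>c. c \<in> C \<Longrightarrow> in_RA A c"
    and pos: "\<And>c. c \<in> C \<Longrightarrow> c \<noteq> 0 \<Longrightarrow> 0 < inner_on A c v"
  obtains m where "0 < m" "\<And>c. c \<in> C \<Longrightarrow> m * (\<Sum>\<alpha>\<in>A. \<bar>c \<alpha>\<bar>) \<le> inner_on A c v"
proof -
  define N where "N c = (\<Sum>\<alpha>\<in>A. \<bar>c \<alpha>\<bar>)" for c :: "'a \<Rightarrow> real"
  define S where "S = {c \<in> C. N c = 1}"
  have "compact S"
    unfolding S_def N_def by (rule compact_sum_abs_slice[OF assms(1,2) RA])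
  have coercive_if: "m * N c \<le> inner_on A c v"
    if c: "c \<in> C" and m: "\<And>c. c \<in> S \<Longrightarrow> m \<le> inner_on A c v" for m c
  proof (cases "c = 0")
    case False
    then have "\<exists>\<alpha>\<in>A. c \<alpha> \<noteq> 0"
      using in_RA_eqI[OF RA[OF c], of 0] by (auto simp: in_RA_def)
    then have "0 < N c"
      unfolding N_def using assms(1) by (auto intro: sum_pos2)
    moreover from this have "(1 / N c) *\<^sub>R c \<in> S"
      using c convex_cone_scaleR[OF assms(3)]
      by (auto simp: S_def N_def abs_mult sum_divide_distrib[symmetric])
    ultimately show ?thesis
      using m[of "(1 / N c) *\<^sub>R c"] by (simp add: inner_on_scaleR_left pos_le_divide_eq)
  qed (simp add: N_def inner_on_zero_left)
  show thesis
  proof (cases "S = {}")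
    case True
    then show thesis using that[of 1] coercive_if[of _ 1] by (simp add: N_def)
  next
    case False
    then obtain c0 where c0: "c0 \<in> S" "\<And>c. c \<in> S \<Longrightarrow> inner_on A c0 v \<le> inner_on A c v"
      using continuous_attains_inf[OF \<open>compact S\<close> _ continuous_on_inner_on[OF continuous_on_id]] by blast
    have "c0 \<noteq> 0" using c0(1) by (auto simp: S_def N_def)
    then have "0 < inner_on A c0 v" using pos[of c0] c0(1) by (simp add: S_def)
    then show thesis using that coercive_if[OF _ c0(2)] by (simp add: N_def)
  qed
qed

lemma compact_cone_sublevel:
  assumes "finite A" "closed C" "convex_cone C" and RA: "\<And>c. c \<in> C \<Longrightarrow> in_RA A c"
    and "\<And>c. c \<in> C \<Longrightarrow> c \<noteq> 0 \<Longrightarrow> 0 < inner_on A c v"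
  shows "compact {c \<in> C. inner_on A c v \<le> b}"
proof -
  obtain m where m: "0 < m" "\<And>c. c \<in> C \<Longrightarrow> m * (\<Sum>\<alpha>\<in>A. \<bar>c \<alpha>\<bar>) \<le> inner_on A c v"
    using positive_functional_coercive[OF assms] by blast
  have "\<bar>c \<alpha>\<bar> \<le> b / m" if c: "c \<in> C" "inner_on A c v \<le> b" and "\<alpha> \<in> A" for c \<alpha>
  proof -
    have "\<bar>c \<alpha>\<bar> \<le> (\<Sum>\<alpha>\<in>A. \<bar>c \<alpha>\<bar>)"
      using assms(1) \<open>\<alpha> \<in> A\<close> by (intro member_le_sum) auto
    also have "\<dots> \<le> b / m"
      using m(1) order_trans[OF m(2)[OF c(1)] c(2)] by (simp add: pos_le_divide_eq mult.commute)
    finally show ?thesis .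
  qed
  moreover have "closed {c \<in> C. inner_on A c v \<le> b}"
    using assms(2) by (simp add: Collect_conj_eq closed_Int closed_Collect_le continuous_intros)
  ultimately show ?thesis
    using RA by (intro compact_in_RA[of _ A "\<lambda>_. b / m"]) auto
qed

lemma msum_iff: "c \<in> msum I C \<longleftrightarrow> (\<exists>cs. (\<forall>i\<in>I. cs i \<in> C i) \<and> c = (\<Sum>i\<in>I. cs i))"
  by (simp add: msum_def fun_eq_iff sum_fun_apply)

lemma convex_cone_msum:
  assumes "\<And>i. i \<in> I \<Longrightarrow> convex_cone (C i)"
  shows "convex_cone (msum I C)"
  unfolding convex_cone_iff
proof (intro conjI ballI allI impI)
  show "0 \<in> msum I C"
    using assms unfolding msum_iff by (intro exI[of _ "\<lambda>_. 0"]) (auto simp: convex_cone_contains_0)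
  show "c + d \<in> msum I C" if "c \<in> msum I C" "d \<in> msum I C" for c d
  proof -
    obtain cs ds where "\<forall>i\<in>I. cs i \<in> C i" "c = (\<Sum>i\<in>I. cs i)" "\<forall>i\<in>I. ds i \<in> C i" "d = (\<Sum>i\<in>I. ds i)"
      using \<open>c \<in> msum I C\<close> \<open>d \<in> msum I C\<close> unfolding msum_iff by blast
    then show ?thesis
      using assms unfolding msum_iff
      by (intro exI[of _ "\<lambda>i. cs i + ds i"]) (auto simp: sum.distrib convex_cone_add)
  qed
  show "k *\<^sub>R c \<in> msum I C" if "0 \<le> k" "c \<in> msum I C" for k c
  proof -
    obtain cs where "\<forall>i\<in>I. cs i \<in> C i" "c = (\<Sum>i\<in>I. cs i)"
      using \<open>c \<in> msum I C\<close> unfolding msum_iff by blast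
    then show ?thesis
      using assms \<open>0 \<le> k\<close> unfolding msum_iff
      by (intro exI[of _ "\<lambda>i. k *\<^sub>R cs i"]) (auto simp: scaleR_sum_right convex_cone_scaleR)
  qed
qed

lemma msum_subset_convex_cone:
  "convex_cone D \<Longrightarrow> (\<And>i. i \<in> I \<Longrightarrow> C i \<subseteq> D) \<Longrightarrow> msum I C \<subseteq> D"
  by (auto simp: msum_iff subset_eq intro!: convex_cone_sum)

lemma subset_msum:
  assumes "finite I" "i \<in> I" "\<And>j. j \<in> I \<Longrightarrow> 0 \<in> C j"
  shows "C i \<subseteq> msum I C"
proof
  fix c assume "c \<in> C i"
  then show "c \<in> msum I C"
    using assms unfolding msum_iff
    by (intro exI[of _ "\<lambda>j. if j = i then c else 0"]) (auto simp: sum.delta)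
qed

lemma compact_msum_sublevel:
  assumes "finite A" "finite I"
    and "\<And>i. i \<in> I \<Longrightarrow> closed (C i)" "\<And>i. i \<in> I \<Longrightarrow> convex_cone (C i)"
    and "\<And>i c. i \<in> I \<Longrightarrow> c \<in> C i \<Longrightarrow> in_RA A c"
    and pos: "\<And>i c. i \<in> I \<Longrightarrow> c \<in> C i \<Longrightarrow> c \<noteq> 0 \<Longrightarrow> 0 < inner_on A c v"
  shows "compact {c \<in> msum I C. inner_on A c v \<le> b}"
proof -
  have slice: "compact {c \<in> C i. inner_on A c v \<le> b}" if "i \<in> I" for i
    using assms that by (intro compact_cone_sublevel) auto
  let ?D = "\<lambda>i. if i \<in> I then {c \<in> C i. inner_on A c v \<le> b} else {0}"
  let ?total = "\<lambda>cs. \<Sum>i\<in>I. cs i"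
  let ?Z = "{cs. \<forall>i. cs i \<in> ?D i} \<inter> {cs. inner_on A (?total cs) v \<le> b}"
  have continuous_total: "continuous_on S ?total" for S :: "('b \<Rightarrow> 'a \<Rightarrow> real) set"
    by (intro continuous_on_coordinatewise_then_product)
      (simp only: sum_fun_apply,
        intro continuous_on_sum continuous_on_product_then_coordinatewise[OF continuous_on_apply])
  have "compact {cs. \<forall>i. cs i \<in> ?D i}"
    using slice by (intro compact_Collect_coordinates) auto
  moreover have "closed {cs. inner_on A (?total cs) v \<le> b}"
    by (rule closed_Collect_le[OF continuous_on_inner_on[OF continuous_total] continuous_on_const])
  ultimately have "compact (?total ` ?Z)"
    by (intro compact_continuous_image continuous_total compact_Int_closed)
  also have "?total ` ?Z = {c \<in> msum I C. inner_on A c v \<le> b}"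
  proof (intro set_eqI iffI)
    fix c assume "c \<in> {c \<in> msum I C. inner_on A c v \<le> b}"
    then obtain cs where cs: "\<forall>i\<in>I. cs i \<in> C i" "c = ?total cs" and le: "inner_on A (?total cs) v \<le> b"
      by (auto simp: msum_iff)
    have "0 \<le> inner_on A (cs i) v" if "i \<in> I" for i
      using pos[OF that, of "cs i"] cs(1) that
      by (cases "cs i = 0") (auto simp: inner_on_zero_left order_le_less)
    then have "inner_on A (cs i) v \<le> b" if "i \<in> I" for i
      using le member_le_sum[of i I "\<lambda>i. inner_on A (cs i) v"] assms(2) that
      by (simp add: inner_on_sum_left)
    then show "c \<in> ?total ` ?Z"
      using cs le by (intro image_eqI[of _ _ "\<lambda>i. if i \<in> I then cs i else 0"]) auto
  next
    fix c assume "c \<in> ?total ` ?Z"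
    then obtain cs where cs: "\<forall>i. cs i \<in> ?D i" "inner_on A (?total cs) v \<le> b" "c = ?total cs"
      by blast
    have "cs i \<in> C i" if "i \<in> I" for i
      using spec[OF cs(1), of i] that by simp
    then show "c \<in> {c \<in> msum I C. inner_on A c v \<le> b}"
      using cs(2,3) unfolding msum_iff by blast
  qed
  finally show ?thesis .
qed

lemma closed_msum:
  assumes "finite A" "finite I"
    and "\<And>i. i \<in> I \<Longrightarrow> closed (C i)" "\<And>i. i \<in> I \<Longrightarrow> convex_cone (C i)"
    and "\<And>i c. i \<in> I \<Longrightarrow> c \<in> C i \<Longrightarrow> in_RA A c"
    and "\<And>i c. i \<in> I \<Longrightarrow> c \<in> C i \<Longrightarrow> c \<noteq> 0 \<Longrightarrow> 0 < inner_on A c v"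
  shows "closed (msum I C)"
proof -
  have "c \<in> msum I C" if c: "c \<in> closure (msum I C)" for c
  proof -
    let ?U = "{d. inner_on A d v < inner_on A c v + 1}"
    let ?K = "{d \<in> msum I C. inner_on A d v \<le> inner_on A c v + 1}"
    have "open ?U"
      by (intro open_Collect_less continuous_intros)
    then have "c \<in> closure (?U \<inter> msum I C)"
      using open_Int_closure_subset c by fastforce
    also have "\<dots> \<subseteq> closure ?K"
      by (intro closure_mono) auto
    also have "\<dots> = ?K"
      using compact_msum_sublevel[OF assms] by (simp add: compact_imp_closed_fun)
    finally show ?thesis by simp
  qed
  then show ?thesis
    using closure_subset_eq by blast
qed

lemma in_RA_expansion:
  assumes "finite A" "in_RA A c"
  shows "c = (\<Sum>\<alpha>\<in>A. c \<alpha> *\<^sub>R indicat_real {\<alpha>})"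
proof
  fix \<gamma>
  have "(\<Sum>\<alpha>\<in>A. c \<alpha> *\<^sub>R indicat_real {\<alpha>}) \<gamma> = (\<Sum>\<alpha>\<in>A. if \<gamma> = \<alpha> then c \<alpha> else 0)"
    unfolding sum_fun_apply by (intro sum.cong) auto
  then show "c \<gamma> = (\<Sum>\<alpha>\<in>A. c \<alpha> *\<^sub>R indicat_real {\<alpha>}) \<gamma>"
    using assms by (simp add: sum.delta' in_RA_def)
qed

lemma closest_point_in_RA:
  assumes "finite A" "closed C" "0 \<in> C" "\<And>s. s \<in> C \<Longrightarrow> in_RA A s"
  obtains s where "s \<in> C" "\<And>u. u \<in> C \<Longrightarrow> inner_on A (c - s) (c - s) \<le> inner_on A (c - u) (c - u)"
proof -
  define D where "D u = inner_on A (c - u) (c - u)" for u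
  have continuous_D: "continuous_on S D" for S
    unfolding D_def inner_on_def fun_diff_def by (intro continuous_intros continuous_on_apply)
  let ?K = "{u \<in> C. D u \<le> D 0}"
  have "closed ?K"
    using assms(2) by (simp add: Collect_conj_eq closed_Int closed_Collect_le continuous_D)
  moreover have "\<bar>u \<alpha>\<bar> \<le> \<bar>c \<alpha>\<bar> + sqrt (D 0)" if "u \<in> ?K" "\<alpha> \<in> A" for u \<alpha>
  proof -
    have "(c \<alpha> - u \<alpha>)\<^sup>2 \<le> D u"
      unfolding D_def inner_on_def using assms(1) that(2)
      by (simp add: power2_eq_square member_le_sum[where f = "\<lambda>\<alpha>. (c \<alpha> - u \<alpha>) * (c \<alpha> - u \<alpha>)"])
    then have "\<bar>c \<alpha> - u \<alpha>\<bar> \<le> sqrt (D 0)"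
      using that(1) by (intro real_le_rsqrt) auto
    then show ?thesis by linarith
  qed
  ultimately have "compact ?K"
    using assms(4) by (intro compact_in_RA[of _ A "\<lambda>\<alpha>. \<bar>c \<alpha>\<bar> + sqrt (D 0)"]) auto
  moreover have "0 \<in> ?K" using assms(3) by simp
  ultimately obtain s where s: "s \<in> ?K" "\<And>u. u \<in> ?K \<Longrightarrow> D s \<le> D u"
    using continuous_attains_inf[OF _ _ continuous_D, of ?K] by blast
  show thesis
  proof (rule that)
    show "s \<in> C" using s(1) by simp
    show "inner_on A (c - s) (c - s) \<le> inner_on A (c - u) (c - u)" if "u \<in> C" for u
      using s that unfolding D_def[symmetric] by (cases "D u \<le> D 0") auto
  qed
qed

lemma nonpos_if_le_small_multiples:
  fixes a b :: real
  assumes "\<And>t. 0 < t \<Longrightarrow> t \<le> 1 \<Longrightarrow> a \<le> t * b"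
  shows "a \<le> 0"
proof (rule ccontr)
  assume "\<not> a \<le> 0"
  then obtain \<epsilon> where \<epsilon>: "0 < \<epsilon>" "- a + \<epsilon> * \<bar>b\<bar> < 0"
    using negative_perturbation[of "- a" "\<bar>b\<bar>"] by auto
  have "a \<le> min 1 \<epsilon> * b" using \<epsilon>(1) by (intro assms) auto
  also have "\<dots> \<le> \<epsilon> * \<bar>b\<bar>"
    using \<epsilon>(1) by (intro order_trans[OF mult_left_mono[OF abs_ge_self] mult_right_mono]) auto
  finally show False using \<epsilon>(2) by simp
qed

lemma closest_point_variational_ineq:
  assumes closest: "\<And>u. u \<in> C \<Longrightarrow> inner_on A (c - s) (c - s) \<le> inner_on A (c - u) (c - u)"
    and segment: "\<And>t. 0 < t \<Longrightarrow> t \<le> 1 \<Longrightarrow> s + t *\<^sub>R u \<in> C"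
  shows "inner_on A u (c - s) \<le> 0"
proof -
  let ?d = "c - s"
  have "2 * inner_on A u ?d \<le> t * inner_on A u u" if t: "0 < t" "t \<le> 1" for t
  proof -
    have "c - (s + t *\<^sub>R u) = ?d + (- t) *\<^sub>R u" by simp
    then have "inner_on A (c - (s + t *\<^sub>R u)) (c - (s + t *\<^sub>R u))
        = inner_on A ?d ?d - t * (2 * inner_on A u ?d - t * inner_on A u u)"
      by (simp only: inner_on_add_left inner_on_add_right inner_on_scaleR_left inner_on_scaleR_right
          inner_on_commute[of A ?d u]) (simp add: algebra_simps)
    then have "0 \<le> - (t * (2 * inner_on A u ?d - t * inner_on A u u))"
      using closest[OF segment[OF t]] by simp
    then show ?thesis using t(1) by (simp add: mult_le_0_iff)
  qed
  then have "2 * inner_on A u ?d \<le> 0"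
    by (rule nonpos_if_le_small_multiples)
  then show ?thesis by simp
qed

lemma closed_convex_cone_separation:
  assumes "finite A" "closed C" "convex_cone C" and RA: "\<And>s. s \<in> C \<Longrightarrow> in_RA A s"
    and c: "in_RA A c" "c \<notin> C"
  obtains v where "\<And>s. s \<in> C \<Longrightarrow> 0 \<le> inner_on A s v" "inner_on A c v < 0"
proof -
  obtain s where s: "s \<in> C" "\<And>u. u \<in> C \<Longrightarrow> inner_on A (c - s) (c - s) \<le> inner_on A (c - u) (c - u)"
    using closest_point_in_RA[OF assms(1,2) convex_cone_contains_0[OF assms(3)] RA] by metis
  define d where "d = c - s"
  have polar: "inner_on A u d \<le> 0" if "u \<in> C" for u
    unfolding d_def using s that assms(3)
    by (intro closest_point_variational_ineq[of C] convex_cone_add convex_cone_scaleR) auto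
  have "inner_on A (- s) d \<le> 0"
    unfolding d_def
  proof (rule closest_point_variational_ineq[OF s(2)])
    show "s + t *\<^sub>R - s \<in> C" if "0 < t" "t \<le> 1" for t
      using convex_cone_scaleR[OF assms(3) _ s(1), of "1 - t"] that by (simp add: scaleR_diff_left)
  qed
  moreover have "0 < inner_on A d d"
  proof -
    obtain \<alpha> where "\<alpha> \<in> A" "d \<alpha> \<noteq> 0"
      using in_RA_eqI[OF c(1) RA[OF s(1)]] s(1) c(2) by (auto simp: d_def)
    then show ?thesis
      unfolding inner_on_def using assms(1)
      by (intro sum_pos2[of A \<alpha>]) (auto simp: zero_less_mult_iff linorder_neq_iff)
  qed
  moreover have "inner_on A c d = inner_on A d d - inner_on A (- s) d"
    by (simp add: d_def inner_on_diff_left inner_on_minus_left)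
  ultimately have "inner_on A c (- d) < 0"
    by (simp add: inner_on_minus_right)
  then show thesis
    using polar by (intro that[of "- d"]) (auto simp: inner_on_minus_right)
qed

section \<open>Support functions\<close>

lemma supp_fun_le_iff: "supp_fun X w \<le> ereal \<tau> \<longleftrightarrow> (\<forall>x\<in>X. w \<bullet> x \<le> \<tau>)"
  by (simp add: supp_fun_def SUP_le_iff)

lemma supp_fun_real:
  assumes "X \<noteq> {}" "supp_fun X w < \<infinity>"
  shows "supp_fun X w = ereal (real_of_ereal (supp_fun X w))"
proof -
  obtain x where "x \<in> X" using assms(1) by auto
  then have "ereal (w \<bullet> x) \<le> supp_fun X w"
    unfolding supp_fun_def by (rule SUP_upper)
  then show ?thesis using assms(2) by (cases "supp_fun X w") auto
qed

definition support_cone :: "'a::euclidean_space set \<Rightarrow> ('a \<times> real) set" where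
  "support_cone X = {(w, \<tau>). \<forall>x\<in>X. w \<bullet> x \<le> \<tau>}"

lemma convex_cone_support_cone: "convex_cone (support_cone X)"
  by (auto simp: convex_cone_iff support_cone_def zero_prod_def inner_add_left add_mono mult_left_mono)

lemma polyhedron_inequalities:
  fixes X :: "'a::euclidean_space set"
  assumes "polyhedron X"
  obtains P :: "('a \<times> real) set" where "finite P" "X = {x. \<forall>p\<in>P. fst p \<bullet> x \<le> snd p}"
proof -
  obtain F where F: "finite F" "X = \<Inter>F" "\<forall>h\<in>F. \<exists>a b. a \<noteq> 0 \<and> h = {x. a \<bullet> x \<le> b}"
    using assms unfolding polyhedron_def by blast
  then obtain a b where halfspace: "\<And>h. h \<in> F \<Longrightarrow> h = {x. a h \<bullet> x \<le> b h}"
    by metis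
  have "X = {x. \<forall>h\<in>F. a h \<bullet> x \<le> b h}"
    using F(2) halfspace by blast
  then show thesis
    using F(1) by (intro that[of "(\<lambda>h. (a h, b h)) ` F"]) auto
qed

lemma linear_functional_Times_real:
  fixes \<phi> :: "'a::euclidean_space \<times> real \<Rightarrow> real"
  assumes "linear \<phi>"
  obtains u where "\<And>w \<tau>. \<phi> (w, \<tau>) = w \<bullet> u + \<tau> * \<phi> (0, 1)"
proof
  fix w \<tau>
  have "linear (\<lambda>w. \<phi> (w, 0))"
    using linear_compose[OF linearI[of "\<lambda>w. (w, 0)"] assms] by (simp add: o_def)
  then have horizontal: "\<phi> (w, 0) = w \<bullet> adjoint (\<lambda>w. \<phi> (w, 0)) 1"
    by (simp add: adjoint_works)
  have "\<phi> (w, \<tau>) = \<phi> (w, 0) + \<tau> * \<phi> (0, 1)"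
    using linear_add[OF assms, of "(w, 0)" "(0, \<tau>)"] linear_cmul[OF assms, of \<tau> "(0, 1)"] by simp
  then show "\<phi> (w, \<tau>) = w \<bullet> adjoint (\<lambda>w. \<phi> (w, 0)) 1 + \<tau> * \<phi> (0, 1)"
    by (simp only: horizontal)
qed

lemma support_cone_eq_convex_cone_hull:
  fixes P :: "('a::euclidean_space \<times> real) set"
  assumes "finite P" "X = {x. \<forall>p\<in>P. fst p \<bullet> x \<le> snd p}" "X \<noteq> {}"
  shows "support_cone X = convex_cone hull (insert (0, 1) P)" (is "_ = convex_cone hull ?G")
proof
  have "?G \<subseteq> support_cone X"
    using assms(2) by (auto simp: support_cone_def)
  then show "convex_cone hull ?G \<subseteq> support_cone X"
    by (simp add: hull_minimal convex_cone_support_cone)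
  obtain x0 where x0: "x0 \<in> X" using assms(3) by blast
  show "support_cone X \<subseteq> convex_cone hull ?G"
  proof (rule ccontr)
    assume "\<not> support_cone X \<subseteq> convex_cone hull ?G"
    then obtain w \<tau> where w: "(w, \<tau>) \<in> support_cone X" "(w, \<tau>) \<notin> convex_cone hull ?G" by auto
    have "linear (\<lambda>p :: 'a \<times> real. snd p - fst p \<bullet> x0)"
      by (intro linearI) (auto simp: inner_add_left algebra_simps)
    moreover have "0 \<le> snd p - fst p \<bullet> x0" if "p \<in> ?G" for p
      using that x0 assms(2) by auto
    ultimately obtain \<phi> :: "'a \<times> real \<Rightarrow> real" where \<phi>: "linear \<phi>" "\<And>p. p \<in> ?G \<Longrightarrow> 0 \<le> \<phi> p"
        "\<phi> (w, \<tau>) < 0" "\<phi> (0, 1) = 1"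
      using convex_cone_hull_separation_normalized[of ?G "(w, \<tau>)" "(0, 1)" "\<lambda>p. snd p - fst p \<bullet> x0"]
        assms(1) w(2) by auto
    obtain u where u: "\<And>w \<tau>. \<phi> (w, \<tau>) = w \<bullet> u + \<tau>"
      using linear_functional_Times_real[OF \<phi>(1)] \<phi>(4) by force
    have "fst p \<bullet> - u \<le> snd p" if "p \<in> P" for p
      using \<phi>(2)[of p] u[of "fst p" "snd p"] that by simp
    then have "- u \<in> X"
      unfolding assms(2) by blast
    then show False
      using w(1) \<phi>(3) by (force simp: support_cone_def u)
  qed
qed

lemma feasible_if_not_in_convex_cone_hull:
  fixes P :: "('a::euclidean_space \<times> real) set"
  assumes "finite P" "(0, - 1) \<notin> convex_cone hull P"
  obtains x where "\<And>p. p \<in> P \<Longrightarrow> fst p \<bullet> x \<le> snd p"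
proof -
  obtain \<phi> :: "'a \<times> real \<Rightarrow> real" where \<phi>: "linear \<phi>" "\<And>p. p \<in> P \<Longrightarrow> 0 \<le> \<phi> p" "\<phi> (0, - 1) < 0"
    using convex_cone_hull_separation[OF assms] by blast
  obtain u where u: "\<And>w \<tau>. \<phi> (w, \<tau>) = w \<bullet> u + \<tau> * \<phi> (0, 1)"
    using linear_functional_Times_real[OF \<phi>(1)] by blast
  have pos: "0 < \<phi> (0, 1)"
    using \<phi>(3) u[of 0 "- 1"] by simp
  show thesis
  proof (rule that)
    fix p assume "p \<in> P"
    then have "0 \<le> fst p \<bullet> u + snd p * \<phi> (0, 1)"
      using \<phi>(2)[of p] u[of "fst p" "snd p"] by simp
    then show "fst p \<bullet> ((- 1 / \<phi> (0, 1)) *\<^sub>R u) \<le> snd p"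
      using pos by (simp add: field_simps)
  qed
qed

section \<open>The cone of a negative index\<close>

lemma linear_Amul: "linear (Amul A)"
  by (intro linearI) (simp_all add: Amul_def scaleR_add_left sum.distrib scaleR_sum_right)

lemma inner_Amul: "Amul A \<nu> \<bullet> x = inner_on A \<nu> (\<lambda>\<alpha>. \<alpha> \<bullet> x)"
  by (simp add: Amul_def inner_on_def inner_sum_left)

lemma in_RA_Nbeta: "\<nu> \<in> Nbeta A \<beta> \<Longrightarrow> in_RA A \<nu>"
  by (simp add: Nbeta_def)

lemma convex_cone_Nbeta: "convex_cone (Nbeta A \<beta>)"
  by (auto simp: convex_cone_iff Nbeta_def in_RA_def sum.distrib simp flip: sum_distrib_left)

lemma inner_on_Nbeta:
  assumes "\<nu> \<in> Nbeta A \<beta>"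
  shows "inner_on A \<nu> f = (\<Sum>\<alpha>\<in>A. \<nu> \<alpha> * (f \<alpha> - f \<beta>))"
proof -
  have "(\<Sum>\<alpha>\<in>A. \<nu> \<alpha> * (f \<alpha> - f \<beta>)) = inner_on A \<nu> f - (\<Sum>\<alpha>\<in>A. \<nu> \<alpha>) * f \<beta>"
    by (simp add: inner_on_def right_diff_distrib sum_subtractf sum_distrib_right)
  then show ?thesis using assms by (simp add: Nbeta_def)
qed

lemma Nbeta_eq_0:
  assumes "finite A" "\<beta> \<in> A" "\<nu> \<in> Nbeta A \<beta>" "\<And>\<alpha>. \<alpha> \<in> A - {\<beta>} \<Longrightarrow> \<nu> \<alpha> = 0"
  shows "\<nu> = 0"
proof (rule in_RA_eqI)
  have "\<nu> \<beta> = 0"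
    using assms by (simp add: Nbeta_def sum.remove)
  then show "\<nu> \<alpha> = 0 \<alpha>" if "\<alpha> \<in> A" for \<alpha>
    using assms(4) that by (cases "\<alpha> = \<beta>") auto
qed (use assms(3) in \<open>auto simp: in_RA_def Nbeta_def\<close>)

lemma Nbeta_neg:
  assumes "finite A" "\<beta> \<in> A" "\<nu> \<in> Nbeta A \<beta>" "\<nu> \<noteq> 0"
  shows "\<nu> \<beta> < 0"
proof -
  have nonneg: "0 \<le> \<nu> \<alpha>" if "\<alpha> \<in> A - {\<beta>}" for \<alpha>
    using assms(3) that by (simp add: Nbeta_def)
  obtain \<alpha> where "\<alpha> \<in> A - {\<beta>}" "\<nu> \<alpha> \<noteq> 0"
    using Nbeta_eq_0[OF assms(1-3)] assms(4) by blast
  then have "0 < (\<Sum>\<alpha>\<in>A - {\<beta>}. \<nu> \<alpha>)"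
    using assms(1) nonneg by (intro sum_pos2[of _ \<alpha>]) (auto simp: order_le_less)
  then show ?thesis
    using assms by (simp add: Nbeta_def sum.remove)
qed

lemma Nbeta_eq_convex_cone_hull:
  assumes "finite A" "\<beta> \<in> A"
  shows "Nbeta A \<beta> = convex_cone hull ((\<lambda>\<alpha>. indicat_real {\<alpha>} - indicat_real {\<beta>}) ` A)"
    (is "_ = convex_cone hull (?g ` A)")
proof
  have "?g \<alpha> \<in> Nbeta A \<beta>" if "\<alpha> \<in> A" for \<alpha>
    using assms that by (auto simp: Nbeta_def in_RA_def sum_subtractf indicator_def)
  then show "convex_cone hull (?g ` A) \<subseteq> Nbeta A \<beta>"
    by (intro hull_minimal convex_cone_Nbeta) auto
  show "Nbeta A \<beta> \<subseteq> convex_cone hull (?g ` A)"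
  proof
    fix \<nu> assume \<nu>: "\<nu> \<in> Nbeta A \<beta>"
    have "\<nu> = (\<Sum>\<alpha>\<in>A. \<nu> \<alpha> *\<^sub>R indicat_real {\<alpha>}) - (\<Sum>\<alpha>\<in>A. \<nu> \<alpha>) *\<^sub>R indicat_real {\<beta>}"
      using \<nu> in_RA_expansion[OF assms(1) in_RA_Nbeta[OF \<nu>]] by (simp add: Nbeta_def)
    also have "\<dots> = (\<Sum>\<alpha>\<in>A. \<nu> \<alpha> *\<^sub>R ?g \<alpha>)"
      by (simp only: scaleR_sum_left scaleR_diff_right sum_subtractf)
    also have "\<dots> \<in> convex_cone hull (?g ` A)"
    proof (intro convex_cone_sum convex_cone_convex_cone_hull)
      show "\<nu> \<alpha> *\<^sub>R ?g \<alpha> \<in> convex_cone hull (?g ` A)" if "\<alpha> \<in> A" for \<alpha>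
      proof (cases "\<alpha> = \<beta>")
        case False
        then show ?thesis
          using \<nu> that by (intro convex_cone_hull_mul hull_inc) (auto simp: Nbeta_def)
      qed (simp add: convex_cone_hull_contains_0)
    qed
    finally show "\<nu> \<in> convex_cone hull (?g ` A)" .
  qed
qed

section \<open>Epigraphs and circuits\<close>

definition support_value :: "'a::euclidean_space set \<Rightarrow> 'a set \<Rightarrow> ('a \<Rightarrow> real) \<Rightarrow> real" where
  "support_value X A \<nu> = real_of_ereal (supp_fun X (- Amul A \<nu>))"

lemma funform_eq: "funform X A \<nu> = (\<nu>, support_value X A \<nu>)"
  by (simp add: funform_def support_value_def)

definition support_epigraph :: "'a::euclidean_space set \<Rightarrow> 'a set \<Rightarrow> 'a \<Rightarrow> (('a \<Rightarrow> real) \<times> real) set" where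
  "support_epigraph X A \<beta> = {(\<nu>, \<tau>). \<nu> \<in> Nbeta A \<beta> \<and> (- Amul A \<nu>, \<tau>) \<in> support_cone X}"

lemma support_epigraph_eq:
  "support_epigraph X A \<beta> = (Nbeta A \<beta> \<times> UNIV) \<inter> (\<lambda>p. (- Amul A (fst p), snd p)) -` support_cone X"
  by (auto simp: support_epigraph_def)

lemma linear_Amul_Times: "linear (\<lambda>p. (- Amul A (fst p), snd p :: real))"
  by (intro linearI) (auto simp: linear_add[OF linear_Amul] linear_cmul[OF linear_Amul])

lemma convex_cone_support_epigraph: "convex_cone (support_epigraph X A \<beta>)"
proof -
  have "convex_cone (Nbeta A \<beta> \<times> (UNIV :: real set))"
    by (simp add: convex_cone_Times convex_cone_Nbeta subspace_imp_convex_cone)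
  moreover have "convex_cone ((\<lambda>p. (- Amul A (fst p), snd p)) -` support_cone X)"
    by (intro convex_cone_linear_vimage linear_Amul_Times convex_cone_support_cone)
  ultimately show ?thesis
    unfolding support_epigraph_eq convex_cone_iff by blast
qed

lemma finitely_generated_cone_support_epigraph:
  assumes "polyhedron X" "X \<noteq> {}" "finite A" "\<beta> \<in> A"
  shows "finitely_generated_cone (support_epigraph X A \<beta>)"
proof -
  obtain P where P: "finite P" "X = {x. \<forall>p\<in>P. fst p \<bullet> x \<le> snd p}"
    using polyhedron_inequalities[OF assms(1)] by blast
  have "finitely_generated_cone (support_cone X)"
    unfolding support_cone_eq_convex_cone_hull[OF P assms(2)] using P(1)
    by (simp add: finitely_generated_cone_hull)
  moreover have "finitely_generated_cone (Nbeta A \<beta>)"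
    unfolding Nbeta_eq_convex_cone_hull[OF assms(3,4)] using assms(3)
    by (simp add: finitely_generated_cone_hull)
  ultimately show ?thesis
    unfolding support_epigraph_eq
    by (intro finitely_generated_cone_linear_vimage finitely_generated_cone_Times
        finitely_generated_cone_UNIV_real linear_Amul_Times)
qed

lemma support_epigraph_iff:
  assumes "X \<noteq> {}"
  shows "(\<nu>, \<tau>) \<in> support_epigraph X A \<beta> \<longleftrightarrow>
    \<nu> \<in> Nbeta A \<beta> \<and> supp_fun X (- Amul A \<nu>) < \<infinity> \<and> support_value X A \<nu> \<le> \<tau>"
proof -
  have "supp_fun X w \<le> ereal \<tau> \<longleftrightarrow> supp_fun X w < \<infinity> \<and> real_of_ereal (supp_fun X w) \<le> \<tau>" for w
  proof (cases "supp_fun X w < \<infinity>")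
    case True
    then obtain r where "supp_fun X w = ereal r"
      using supp_fun_real[OF assms] by blast
    then show ?thesis by simp
  qed simp
  then show ?thesis
    by (simp add: support_epigraph_def support_cone_def support_value_def flip: supp_fun_le_iff)
qed

lemma extreme_ray_support_epigraph_tight:
  assumes "X \<noteq> {}" "extreme_ray (support_epigraph X A \<beta>) p" "fst p \<noteq> 0"
  shows "p = funform X A (fst p)"
proof -
  obtain \<nu> \<tau> where p: "p = (\<nu>, \<tau>)" by (cases p)
  have "(\<nu>, \<tau>) \<in> support_epigraph X A \<beta>"
    using assms(2) by (simp add: extreme_ray_iff p)
  then have \<nu>: "(\<nu>, support_value X A \<nu>) \<in> support_epigraph X A \<beta>" "support_value X A \<nu> \<le> \<tau>"
    by (auto simp: support_epigraph_iff[OF assms(1)])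
  then have "(0, \<tau> - support_value X A \<nu>) \<in> support_epigraph X A \<beta>"
    by (simp add: support_epigraph_def support_cone_def linear_0[OF linear_Amul]
        convex_cone_contains_0[OF convex_cone_Nbeta])
  moreover have "(\<nu>, support_value X A \<nu>) + (0, \<tau> - support_value X A \<nu>) \<in> ray p"
    using ray_self[of p] by (simp add: p)
  ultimately have "(0, \<tau> - support_value X A \<nu>) \<in> ray p"
    using assms(2) \<nu>(1) unfolding extreme_ray_iff by blast
  then show ?thesis
    using assms(3) by (auto simp: ray_eq p funform_eq)
qed

lemma proportional_if_multiples:
  assumes "s \<noteq> 0" "s *\<^sub>R u = a *\<^sub>R w" "t \<noteq> 0" "t *\<^sub>R v = b *\<^sub>R w"
  shows "proportional u v"
proof (cases "b = 0")
  case True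
  then have "v = 0" using assms(3,4) by simp
  then have "v = (\<lambda>\<alpha>. 0 * u \<alpha>)" by (simp add: zero_fun_def)
  then show ?thesis unfolding proportional_def by blast
next
  case False
  have "u = (1 / s) *\<^sub>R (s *\<^sub>R u)" using assms(1) by simp
  also have "\<dots> = (a / s / b) *\<^sub>R (b *\<^sub>R w)" using False by (simp add: assms(2))
  also have "\<dots> = (a / s / b * t) *\<^sub>R v" by (simp flip: assms(4))
  finally have "u = (\<lambda>\<alpha>. (a / s / b * t) * v \<alpha>)"
    by (simp add: fun_eq_iff)
  then show ?thesis unfolding proportional_def by blast
qed

lemma X_circuit_if_extreme_ray:
  assumes "X \<noteq> {}" "extreme_ray (support_epigraph X A \<beta>) (funform X A \<nu>)" "\<nu> \<noteq> 0"
  shows "X_circuit X A \<beta> \<nu>"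
  unfolding X_circuit_def
proof (intro conjI notI)
  let ?E = "support_epigraph X A \<beta>"
  have "(\<nu>, support_value X A \<nu>) \<in> ?E"
    using assms(2) by (simp add: extreme_ray_iff funform_eq)
  then show "\<nu> \<in> Nbeta A \<beta>" and "supp_fun X (- Amul A \<nu>) < \<infinity>"
    by (auto simp: support_epigraph_iff[OF assms(1)])
  show False if "\<nu> = (\<lambda>_. 0)"
    using that assms(3) by (simp add: zero_fun_def)
  assume "\<exists>\<nu>1 \<nu>2 \<theta>. \<nu>1 \<in> Nbeta A \<beta> \<and> \<nu>2 \<in> Nbeta A \<beta> \<and> \<not> proportional \<nu>1 \<nu>2 \<and>
      \<theta> \<in> {0<..<1::real} \<and> \<nu> = (\<lambda>\<alpha>. \<theta> * \<nu>1 \<alpha> + (1 - \<theta>) * \<nu>2 \<alpha>) \<and> affine_on_segment X A \<nu>1 \<nu>2"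
  then obtain \<nu>1 \<nu>2 \<theta> a b where endpoints: "\<nu>1 \<in> Nbeta A \<beta>" "\<nu>2 \<in> Nbeta A \<beta>" "\<not> proportional \<nu>1 \<nu>2"
    and \<theta>: "0 < \<theta>" "\<theta> < 1" "\<nu> = (\<lambda>\<alpha>. \<theta> * \<nu>1 \<alpha> + (1 - \<theta>) * \<nu>2 \<alpha>)"
    and affine: "\<And>t. t \<in> {0..1} \<Longrightarrow>
      supp_fun X (- Amul A (\<lambda>\<alpha>. (1 - t) * \<nu>1 \<alpha> + t * \<nu>2 \<alpha>)) = ereal (a + b * t)"
    unfolding affine_on_segment_def by auto
  have "(\<nu>1, a) \<in> ?E" "(\<nu>2, a + b) \<in> ?E"
    using endpoints affine[of 0] affine[of 1]
    by (auto simp: support_epigraph_iff[OF assms(1)] support_value_def)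
  then have "\<theta> *\<^sub>R (\<nu>1, a) \<in> ?E" "(1 - \<theta>) *\<^sub>R (\<nu>2, a + b) \<in> ?E"
    using \<theta>
    by (simp_all only: convex_cone_scaleR[OF convex_cone_support_epigraph] less_imp_le diff_ge_0_iff_ge)
  moreover have "\<theta> *\<^sub>R (\<nu>1, a) + (1 - \<theta>) *\<^sub>R (\<nu>2, a + b) \<in> ray (funform X A \<nu>)"
  proof -
    have "supp_fun X (- Amul A \<nu>) = ereal (a + b * (1 - \<theta>))"
      using affine[of "1 - \<theta>"] \<theta>(1,2) unfolding \<theta>(3) by simp
    moreover have "\<theta> *\<^sub>R \<nu>1 + (1 - \<theta>) *\<^sub>R \<nu>2 = \<nu>"
      by (simp add: \<theta>(3) fun_eq_iff)
    ultimately have "\<theta> *\<^sub>R (\<nu>1, a) + (1 - \<theta>) *\<^sub>R (\<nu>2, a + b) = funform X A \<nu>"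
      by (simp add: funform_def algebra_simps)
    then show ?thesis
      by (simp only: ray_self)
  qed
  ultimately have "\<theta> *\<^sub>R (\<nu>1, a) \<in> ray (funform X A \<nu>)" "(1 - \<theta>) *\<^sub>R (\<nu>2, a + b) \<in> ray (funform X A \<nu>)"
    using assms(2) unfolding extreme_ray_iff by blast+
  then obtain t1 t2 where "\<theta> *\<^sub>R \<nu>1 = t1 *\<^sub>R \<nu>" "(1 - \<theta>) *\<^sub>R \<nu>2 = t2 *\<^sub>R \<nu>"
    by (auto simp: ray_eq funform_eq)
  then show False
    using endpoints(3) \<theta> proportional_if_multiples[of \<theta> \<nu>1 t1 \<nu> "1 - \<theta>" \<nu>2 t2] by simp
qed

lemma Lambda_XE:
  assumes "lam \<in> Lambda_X X A"
  obtains \<beta> where "\<beta> \<in> A" "lam \<in> Nbeta A \<beta>" "lam \<beta> = -1" "supp_fun X (- Amul A lam) < \<infinity>"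
  using assms by (auto simp: Lambda_X_def X_circuit_def)

lemma funform_in_support_epigraph:
  assumes "X \<noteq> {}" "lam \<in> Lambda_X X A"
  obtains \<beta> where "\<beta> \<in> A" "funform X A lam \<in> support_epigraph X A \<beta>"
proof -
  obtain \<beta> where "\<beta> \<in> A" "lam \<in> Nbeta A \<beta>" "supp_fun X (- Amul A lam) < \<infinity>"
    using assms(2) by (elim Lambda_XE)
  then show thesis
    using that by (simp add: support_epigraph_iff[OF assms(1)] funform_eq)
qed

lemma extreme_ray_support_epigraph_circuit:
  assumes "X \<noteq> {}" "finite A" "\<beta> \<in> A" "extreme_ray (support_epigraph X A \<beta>) p" "fst p \<noteq> 0"
  obtains lam k where "lam \<in> Lambda_X X A" "0 < k" "p = k *\<^sub>R funform X A lam"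
proof -
  have "p \<in> support_epigraph X A \<beta>"
    using assms(4) by (simp add: extreme_ray_iff)
  then have "fst p \<in> Nbeta A \<beta>"
    by (auto simp: support_epigraph_def)
  then have r: "0 < - fst p \<beta>" (is "0 < ?r")
    using Nbeta_neg[OF assms(2,3)] assms(5) by simp
  define q where "q = (1 / ?r) *\<^sub>R p"
  have q: "extreme_ray (support_epigraph X A \<beta>) q"
    unfolding q_def using assms(4) r by (intro extreme_ray_scaleR convex_cone_support_epigraph) auto
  have normalized: "fst q \<beta> = - 1"
    using r by (simp add: q_def)
  then have "fst q \<noteq> 0" by auto
  then have q_eq: "q = funform X A (fst q)"
    by (rule extreme_ray_support_epigraph_tight[OF assms(1) q])
  then have "X_circuit X A \<beta> (fst q)"
    using q \<open>fst q \<noteq> 0\<close> by (intro X_circuit_if_extreme_ray[OF assms(1)]) simp_all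
  then have "fst q \<in> Lambda_X X A"
    using assms(3) normalized by (auto simp: Lambda_X_def)
  moreover have "p = ?r *\<^sub>R q" using r by (simp add: q_def)
  ultimately show thesis
    using that[of "fst q" ?r] r by (simp flip: q_eq)
qed

lemma Lambda_X_star_subset: "Lambda_X_star X A \<subseteq> Lambda_X X A"
  by (auto simp: Lambda_X_star_def)

lemma Lambda_X_eq_if_multiple:
  assumes lam: "lam \<in> Lambda_X X A" and mu: "mu \<in> Lambda_X X A" and eq: "mu = k *\<^sub>R lam" "0 \<le> k"
  shows "mu = lam"
proof -
  obtain \<beta> where \<beta>: "lam \<in> Nbeta A \<beta>" "lam \<beta> = -1"
    using lam by (elim Lambda_XE)
  obtain \<gamma> where \<gamma>: "\<gamma> \<in> A" "mu \<gamma> = -1"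
    using mu by (elim Lambda_XE)
  have k: "k * lam \<gamma> = -1" using \<gamma>(2) eq(1) by simp
  then have "lam \<gamma> < 0"
    using eq(2) by (metis mult_nonneg_nonneg neg_0_le_iff_le not_less not_one_le_zero)
  then have "\<gamma> = \<beta>" using \<beta>(1) \<gamma>(1) by (force simp: Nbeta_def)
  then show ?thesis using k \<beta>(2) eq(1) by simp
qed

lemma inj_on_ray_funform: "inj_on (\<lambda>lam. ray (funform X A lam)) (Lambda_X X A)"
proof (rule inj_onI)
  fix lam mu assume lam: "lam \<in> Lambda_X X A" and mu: "mu \<in> Lambda_X X A"
    and "ray (funform X A lam) = ray (funform X A mu)"
  then have "funform X A lam \<in> ray (funform X A mu)" using ray_self by metis
  then obtain t where "0 \<le> t" "lam = t *\<^sub>R mu" by (auto simp: ray_eq funform_eq)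
  then show "lam = mu" by (intro Lambda_X_eq_if_multiple[OF mu lam])
qed

lemma circuit_graph_eq:
  "circuit_graph X A = convex_cone hull (insert (0, 1) (funform X A ` Lambda_X X A))"
  by (simp add: circuit_graph_def cone_hull_eq zero_fun_def)

section \<open>Affine functionals on epigraphs\<close>

definition affine_pairing :: "'a set \<Rightarrow> ('a \<Rightarrow> real) \<Rightarrow> ('a \<Rightarrow> real) \<times> real \<Rightarrow> real" where
  "affine_pairing A y p = inner_on A (fst p) y + snd p"

lemma linear_affine_pairing: "linear (affine_pairing A y)"
  by (intro linearI)
    (simp_all add: affine_pairing_def inner_on_add_left inner_on_scaleR_left algebra_simps)

lemma inner_on_indicator:
  assumes "finite A" "\<alpha> \<in> A"
  shows "inner_on A (indicat_real {\<alpha>}) f = f \<alpha>"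
proof -
  have "inner_on A (indicat_real {\<alpha>}) f = (\<Sum>\<gamma>\<in>A. if \<gamma> = \<alpha> then f \<gamma> else 0)"
    unfolding inner_on_def by (intro sum.cong) auto
  then show ?thesis using assms by simp
qed

lemma Amul_indicator:
  assumes "finite A" "\<alpha> \<in> A"
  shows "Amul A (indicat_real {\<alpha>}) = \<alpha>"
  by (rule vector_eq_rdot[THEN iffD1]) (simp add: inner_Amul inner_on_indicator[OF assms])

lemma affine_pairing_support_epigraph_ge:
  assumes "b \<in> X" "(\<nu>, \<tau>) \<in> support_epigraph X A \<beta>"
  shows "(\<Sum>\<alpha>\<in>A. \<nu> \<alpha> * (y \<alpha> - y \<beta> - (\<alpha> - \<beta>) \<bullet> b)) \<le> affine_pairing A y (\<nu>, \<tau>)"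
proof -
  have \<nu>: "\<nu> \<in> Nbeta A \<beta>" and b: "- Amul A \<nu> \<bullet> b \<le> \<tau>"
    using assms by (auto simp: support_epigraph_def support_cone_def)
  have "(\<Sum>\<alpha>\<in>A. \<nu> \<alpha> * (y \<alpha> - y \<beta> - (\<alpha> - \<beta>) \<bullet> b)) = inner_on A \<nu> y - Amul A \<nu> \<bullet> b"
    by (simp add: inner_Amul inner_on_Nbeta[OF \<nu>] inner_diff_left right_diff_distrib sum_subtractf)
  then show ?thesis
    using b by (simp add: affine_pairing_def)
qed

lemma affine_pairing_separation:
  assumes "finite A" "finite T" and RA: "\<And>s. s \<in> T \<Longrightarrow> in_RA A (fst s)" "in_RA A (fst p)"
    and p: "p \<notin> convex_cone hull (insert (0, 1) T)"
    and y0: "\<And>s. s \<in> T \<Longrightarrow> 0 \<le> affine_pairing A y0 s"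
  obtains y where "\<And>s. s \<in> T \<Longrightarrow> 0 \<le> affine_pairing A y s" "affine_pairing A y p < 0"
proof -
  have vertical: "affine_pairing A y0 (0, 1) = 1"
    by (simp add: affine_pairing_def inner_on_zero_left)
  then have nonneg: "\<And>s. s \<in> insert (0, 1) T \<Longrightarrow> 0 \<le> affine_pairing A y0 s"
    using y0 by (metis insertE zero_le_one)
  obtain \<phi> :: "('a \<Rightarrow> real) \<times> real \<Rightarrow> real" where \<phi>: "linear \<phi>"
      "\<And>s. s \<in> insert (0, 1) T \<Longrightarrow> 0 \<le> \<phi> s" "\<phi> p < 0" "\<phi> (0, 1) = 1"
    by (rule convex_cone_hull_separation_normalized[OF _ p insertI1 linear_affine_pairing nonneg])
      (simp_all add: assms(2) vertical)
  define y where "y \<alpha> = \<phi> (indicat_real {\<alpha>}, 0)" for \<alpha>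
  have pairing: "\<phi> q = affine_pairing A y q" if "in_RA A (fst q)" for q
  proof -
    have "(\<Sum>\<alpha>\<in>A. fst q \<alpha> *\<^sub>R (indicat_real {\<alpha>}, 0)) + snd q *\<^sub>R (0, 1) = q"
      by (simp add: prod_eq_iff fst_sum snd_sum flip: in_RA_expansion[OF assms(1) that])
    moreover have "\<phi> ((\<Sum>\<alpha>\<in>A. fst q \<alpha> *\<^sub>R (indicat_real {\<alpha>}, 0)) + snd q *\<^sub>R (0, 1)) = affine_pairing A y q"
      by (simp only: linear_add[OF \<phi>(1)] linear_sum[OF \<phi>(1)] linear_cmul[OF \<phi>(1)] \<phi>(4))
        (simp add: affine_pairing_def inner_on_def y_def)
    ultimately show ?thesis by simp
  qed
  show thesis
  proof (rule that)
    show "0 \<le> affine_pairing A y s" if "s \<in> T" for s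
      using \<phi>(2)[of s] that pairing[OF RA(1)[OF that]] by simp
    show "affine_pairing A y p < 0"
      using \<phi>(3) pairing[OF RA(2)] by simp
  qed
qed

lemma ex_point_below:
  assumes "polyhedron X" "finite A" and \<beta>: "\<beta> \<in> A"
    and y: "\<And>p. p \<in> support_epigraph X A \<beta> \<Longrightarrow> 0 \<le> affine_pairing A y p"
  obtains x where "x \<in> X" "\<And>\<alpha>. \<alpha> \<in> A \<Longrightarrow> (\<alpha> - \<beta>) \<bullet> x \<le> y \<alpha> - y \<beta>"
proof -
  obtain P where P: "finite P" "X = {x. \<forall>p\<in>P. fst p \<bullet> x \<le> snd p}"
    using polyhedron_inequalities[OF assms(1)] by blast
  let ?h = "\<lambda>\<alpha>. (\<alpha> - \<beta>, y \<alpha> - y \<beta>)" and ?L = "\<lambda>\<nu>. (Amul A \<nu>, inner_on A \<nu> y)"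
  let ?g = "\<lambda>\<alpha>. indicat_real {\<alpha>} - indicat_real {\<beta>}"
  have linear_L: "linear ?L"
    by (intro linearI) (simp_all add: linear_add[OF linear_Amul] linear_cmul[OF linear_Amul]
        inner_on_add_left inner_on_scaleR_left)
  have image: "?L ` ?g ` A = ?h ` A"
    unfolding image_image using assms(2) \<beta>
    by (intro image_cong)
      (simp_all add: linear_diff[OF linear_Amul] inner_on_diff_left Amul_indicator inner_on_indicator)
  have hull_h: "convex_cone hull (?h ` A) = ?L ` Nbeta A \<beta>"
    unfolding Nbeta_eq_convex_cone_hull[OF assms(2) \<beta>] image[symmetric]
    by (rule convex_cone_hull_linear_image[OF linear_L])
  have "(0, - 1) \<notin> convex_cone hull (P \<union> ?h ` A)"
  proof
    assume "(0, - 1) \<in> convex_cone hull (P \<union> ?h ` A)"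
    then obtain q \<nu> where q: "q \<in> convex_cone hull P" and \<nu>: "\<nu> \<in> Nbeta A \<beta>"
      and sum: "(0, - 1) = q + ?L \<nu>"
      by (elim convex_cone_hull_UnE) (auto simp: hull_h)
    have "q = (- Amul A \<nu>, - 1 - inner_on A \<nu> y)"
      using sum by (auto simp: prod_eq_iff eq_neg_iff_add_eq_0)
    moreover have "convex_cone hull P \<subseteq> support_cone X"
      using P(2) by (intro hull_minimal convex_cone_support_cone) (auto simp: support_cone_def)
    ultimately have "(\<nu>, - 1 - inner_on A \<nu> y) \<in> support_epigraph X A \<beta>"
      using q \<nu> by (auto simp: support_epigraph_def)
    from y[OF this] show False by (simp add: affine_pairing_def)
  qed
  then obtain x where x: "\<And>p. p \<in> P \<union> ?h ` A \<Longrightarrow> fst p \<bullet> x \<le> snd p"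
    using feasible_if_not_in_convex_cone_hull[of "P \<union> ?h ` A"] P(1) assms(2) by auto
  show thesis
  proof (rule that)
    show "x \<in> X" unfolding P(2) using x by blast
    show "(\<alpha> - \<beta>) \<bullet> x \<le> y \<alpha> - y \<beta>" if "\<alpha> \<in> A" for \<alpha>
      using x[of "?h \<alpha>"] that by simp
  qed
qed

section \<open>A strictly positive functional\<close>

lemma ex_exponents_separated:
  assumes "exp_lin_indep_on X A" "finite A" "\<alpha> \<in> A" "\<beta> \<in> A" "\<alpha> \<noteq> \<beta>"
  shows "\<exists>x\<in>X. \<exists>x'\<in>X. (\<alpha> - \<beta>) \<bullet> x \<noteq> (\<alpha> - \<beta>) \<bullet> x'"
proof (rule ccontr)
  assume "\<not> ?thesis"
  then obtain k where k: "\<And>x. x \<in> X \<Longrightarrow> (\<alpha> - \<beta>) \<bullet> x = k"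
    by metis
  define c where "c \<gamma> = (if \<gamma> = \<alpha> then 1 else if \<gamma> = \<beta> then - exp k else 0)" for \<gamma>
  have "(\<Sum>\<gamma>\<in>A. c \<gamma> * exp (\<gamma> \<bullet> x)) = 0" if "x \<in> X" for x
  proof -
    have "(\<Sum>\<gamma>\<in>A. c \<gamma> * exp (\<gamma> \<bullet> x)) = (\<Sum>\<gamma>\<in>{\<alpha>, \<beta>}. c \<gamma> * exp (\<gamma> \<bullet> x))"
      using assms by (intro sum.mono_neutral_right) (auto simp: c_def)
    also have "\<dots> = exp (\<alpha> \<bullet> x) - exp (k + \<beta> \<bullet> x)"
      using assms(5) by (simp add: c_def exp_add)
    also have "k + \<beta> \<bullet> x = \<alpha> \<bullet> x"
      using k[OF that] by (simp add: inner_diff_left)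
    finally show ?thesis by simp
  qed
  then have "c \<alpha> = 0"
    using assms unfolding exp_lin_indep_on_def by blast
  then show False by (simp add: c_def)
qed

lemma ex_finite_separating_subset:
  assumes "exp_lin_indep_on X A" "finite A" "X \<noteq> {}"
  obtains F where "finite F" "F \<noteq> {}" "F \<subseteq> X"
    "\<And>\<alpha> \<beta>. \<alpha> \<in> A \<Longrightarrow> \<beta> \<in> A \<Longrightarrow> \<alpha> \<noteq> \<beta> \<Longrightarrow> \<exists>x\<in>F. \<exists>x'\<in>F. (\<alpha> - \<beta>) \<bullet> x \<noteq> (\<alpha> - \<beta>) \<bullet> x'"
proof -
  obtain x0 where x0: "x0 \<in> X" using assms(3) by blast
  obtain u v where separating: "\<And>\<alpha> \<beta>. \<alpha> \<in> A \<Longrightarrow> \<beta> \<in> A \<Longrightarrow> \<alpha> \<noteq> \<beta> \<Longrightarrow>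
      u \<alpha> \<beta> \<in> X \<and> v \<alpha> \<beta> \<in> X \<and> (\<alpha> - \<beta>) \<bullet> u \<alpha> \<beta> \<noteq> (\<alpha> - \<beta>) \<bullet> v \<alpha> \<beta>"
    using ex_exponents_separated[OF assms(1,2)] by metis
  show thesis
  proof (rule that)
    let ?D = "A \<times> A - Id"
    let ?F = "insert x0 ((\<lambda>(\<alpha>, \<beta>). u \<alpha> \<beta>) ` ?D \<union> (\<lambda>(\<alpha>, \<beta>). v \<alpha> \<beta>) ` ?D)"
    show "finite ?F" "?F \<noteq> {}" "?F \<subseteq> X" using assms(2) x0 separating by auto
    fix \<alpha> \<beta> assume "\<alpha> \<in> A" "\<beta> \<in> A" "\<alpha> \<noteq> \<beta>"
    then show "\<exists>x\<in>?F. \<exists>x'\<in>?F. (\<alpha> - \<beta>) \<bullet> x \<noteq> (\<alpha> - \<beta>) \<bullet> x'"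
      using separating[of \<alpha> \<beta>] by (intro bexI[of _ "u \<alpha> \<beta>"] bexI[of _ "v \<alpha> \<beta>"]) force+
  qed
qed

lemma exp_weighted_mean_less:
  fixes w z :: "'i \<Rightarrow> real"
  assumes "finite F" "\<And>i. i \<in> F \<Longrightarrow> 0 < w i" "(\<Sum>i\<in>F. w i) = 1" "i \<in> F" "j \<in> F" "z i \<noteq> z j"
  shows "exp (\<Sum>i\<in>F. w i * z i) < (\<Sum>i\<in>F. w i * exp (z i))"
proof -
  define m where "m = (\<Sum>i\<in>F. w i * z i)"
  have tangent: "1 + (z k - m) < exp (z k - m)" if "z k \<noteq> m" for k
    using exp_minus_greater[of "m - z k"] that by simp
  obtain k where k: "k \<in> F" "z k \<noteq> m" using assms(4-6) by metis
  have "1 = (\<Sum>i\<in>F. w i * (1 + (z i - m)))"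
    using assms(3)
    by (simp add: distrib_left right_diff_distrib sum.distrib sum_subtractf
        flip: sum_distrib_right m_def)
  also have "\<dots> < (\<Sum>i\<in>F. w i * exp (z i - m))"
  proof (rule sum_strict_mono_ex1[OF assms(1)])
    show "\<forall>i\<in>F. w i * (1 + (z i - m)) \<le> w i * exp (z i - m)"
      using assms(2) by (simp add: less_imp_le mult_left_mono)
    show "\<exists>i\<in>F. w i * (1 + (z i - m)) < w i * exp (z i - m)"
      using k assms(2) tangent by (intro bexI[of _ k]) simp_all
  qed
  also have "\<dots> = (\<Sum>i\<in>F. w i * exp (z i)) / exp m"
    by (simp add: exp_diff sum_divide_distrib)
  finally show ?thesis by (simp add: m_def[symmetric])
qed

definition log_sum_exp :: "'a::euclidean_space set \<Rightarrow> 'a \<Rightarrow> real" where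
  "log_sum_exp F \<alpha> = ln (\<Sum>x\<in>F. exp (\<alpha> \<bullet> x))"

text \<open>The point \<open>b\<close> is the gradient of the log-sum-exp function at \<open>\<beta>\<close>.\<close>

lemma log_sum_exp_strict_subgradient:
  assumes "finite F" "F \<noteq> {}"
  obtains b where "b \<in> convex hull F"
    "\<And>\<alpha> x x'. x \<in> F \<Longrightarrow> x' \<in> F \<Longrightarrow> (\<alpha> - \<beta>) \<bullet> x \<noteq> (\<alpha> - \<beta>) \<bullet> x' \<Longrightarrow>
      (\<alpha> - \<beta>) \<bullet> b < log_sum_exp F \<alpha> - log_sum_exp F \<beta>"
proof -
  define S where "S \<alpha> = (\<Sum>x\<in>F. exp (\<alpha> \<bullet> x))" for \<alpha>
  have S: "0 < S \<alpha>" for \<alpha>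
    unfolding S_def using assms by (intro sum_pos) auto
  define w where "w x = exp (\<beta> \<bullet> x) / S \<beta>" for x
  have w: "0 < w x" "(\<Sum>x\<in>F. w x) = 1" for x
    using S[of \<beta>] by (simp_all add: w_def S_def flip: sum_divide_distrib)
  show thesis
  proof (rule that)
    show "(\<Sum>x\<in>F. w x *\<^sub>R x) \<in> convex hull F"
      using assms(1) w by (intro convex_sum convex_convex_hull) (auto simp: less_imp_le hull_inc)
    fix \<alpha> x x' assume separated: "x \<in> F" "x' \<in> F" "(\<alpha> - \<beta>) \<bullet> x \<noteq> (\<alpha> - \<beta>) \<bullet> x'"
    have "exp ((\<alpha> - \<beta>) \<bullet> (\<Sum>x\<in>F. w x *\<^sub>R x)) < (\<Sum>x\<in>F. w x * exp ((\<alpha> - \<beta>) \<bullet> x))"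
      using exp_weighted_mean_less[OF assms(1) _ w(2) separated] w(1) by (simp add: inner_sum_right)
    also have "\<dots> = S \<alpha> / S \<beta>"
      by (simp add: w_def S_def inner_diff_left exp_diff sum_divide_distrib)
    also have "\<dots> = exp (ln (S \<alpha>) - ln (S \<beta>))"
      using S by (simp add: exp_diff)
    finally show "(\<alpha> - \<beta>) \<bullet> (\<Sum>x\<in>F. w x *\<^sub>R x) < log_sum_exp F \<alpha> - log_sum_exp F \<beta>"
      by (simp add: log_sum_exp_def S_def)
  qed
qed

lemma ex_strictly_positive_pairing:
  assumes "convex X" "X \<noteq> {}" "finite A" "exp_lin_indep_on X A"
  obtains y where
    "\<And>\<beta> p. \<beta> \<in> A \<Longrightarrow> p \<in> support_epigraph X A \<beta> \<Longrightarrow> p \<noteq> 0 \<Longrightarrow> 0 < affine_pairing A y p"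
proof -
  obtain F where F: "finite F" "F \<noteq> {}" "F \<subseteq> X"
    "\<And>\<alpha> \<beta>. \<alpha> \<in> A \<Longrightarrow> \<beta> \<in> A \<Longrightarrow> \<alpha> \<noteq> \<beta> \<Longrightarrow> \<exists>x\<in>F. \<exists>x'\<in>F. (\<alpha> - \<beta>) \<bullet> x \<noteq> (\<alpha> - \<beta>) \<bullet> x'"
    using ex_finite_separating_subset[OF assms(4,3,2)] by metis
  define y where "y = log_sum_exp F"
  have "0 < affine_pairing A y p" if \<beta>: "\<beta> \<in> A" and p: "p \<in> support_epigraph X A \<beta>" "p \<noteq> 0" for \<beta> p
  proof -
    obtain \<nu> \<tau> where p_eq: "p = (\<nu>, \<tau>)" by (cases p)
    obtain b where b: "b \<in> X" "\<And>\<alpha>. \<alpha> \<in> A - {\<beta>} \<Longrightarrow> (\<alpha> - \<beta>) \<bullet> b < y \<alpha> - y \<beta>"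
      using log_sum_exp_strict_subgradient[OF F(1,2), of \<beta>] F(4)[OF _ \<beta>]
        hull_minimal[of F X convex, OF F(3) assms(1)]
      unfolding y_def by (metis DiffE singletonI subsetD)
    have \<nu>: "\<nu> \<in> Nbeta A \<beta>" using p(1) by (simp add: p_eq support_epigraph_def)
    show ?thesis
    proof (cases "\<nu> = 0")
      case True
      then have "0 \<le> \<tau>" "\<tau> \<noteq> 0"
        using p b(1) by (auto simp: p_eq zero_prod_def support_epigraph_def support_cone_def
            linear_0[OF linear_Amul])
      then show ?thesis by (simp add: True p_eq affine_pairing_def inner_on_zero_left)
    next
      case False
      then obtain \<alpha> where \<alpha>: "\<alpha> \<in> A - {\<beta>}" "\<nu> \<alpha> \<noteq> 0"
        using Nbeta_eq_0[OF assms(3) \<beta> \<nu>] by blast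
      have "0 \<le> \<nu> \<gamma> * (y \<gamma> - y \<beta> - (\<gamma> - \<beta>) \<bullet> b)" if "\<gamma> \<in> A" for \<gamma>
        using \<nu> b(2)[of \<gamma>] that by (cases "\<gamma> = \<beta>") (auto simp: Nbeta_def less_imp_le)
      moreover have "0 < \<nu> \<alpha> * (y \<alpha> - y \<beta> - (\<alpha> - \<beta>) \<bullet> b)"
        using \<nu> \<alpha> b(2)[OF \<alpha>(1)] by (auto simp: Nbeta_def order_le_less)
      ultimately have "0 < (\<Sum>\<gamma>\<in>A. \<nu> \<gamma> * (y \<gamma> - y \<beta> - (\<gamma> - \<beta>) \<bullet> b))"
        using assms(3) \<alpha>(1) by (intro sum_pos2[of A \<alpha>]) auto
      also have "\<dots> \<le> affine_pairing A y p"
        using affine_pairing_support_epigraph_ge[OF b(1)] p(1) by (simp add: p_eq)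
      finally show ?thesis .
    qed
  qed
  then show thesis using that by blast
qed

section \<open>The circuit graph\<close>

locale signomial_cones =
  fixes X :: "'a::euclidean_space set" and A :: "'a set"
  assumes nonempty: "X \<noteq> {}" and finite_exponents: "finite A"
begin

abbreviation "epi \<equiv> support_epigraph X A"

abbreviation "pairing \<equiv> affine_pairing A"

end

locale polyhedral_signomial_cones = signomial_cones +
  assumes polyhedron: "polyhedron X" and exponents_nonempty: "A \<noteq> {}"
    and indep: "exp_lin_indep_on X A"
begin

lemma ex_strictly_positive_pairing_epi:
  obtains y where "\<And>\<beta> p. \<beta> \<in> A \<Longrightarrow> p \<in> epi \<beta> \<Longrightarrow> p \<noteq> 0 \<Longrightarrow> 0 < pairing y p"
  using ex_strictly_positive_pairing[OF polyhedron_imp_convex[OF polyhedron] nonempty finite_exponents indep]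
  by blast

lemma epi_subset_circuit_graph:
  assumes "\<beta> \<in> A"
  shows "epi \<beta> \<subseteq> circuit_graph X A"
proof -
  have "p \<in> circuit_graph X A" if p: "extreme_ray (epi \<beta>) p" for p
  proof (cases "fst p = 0")
    case True
    have "0 \<le> snd p"
      using p True nonempty
      by (auto simp: extreme_ray_iff support_epigraph_def support_cone_def linear_0[OF linear_Amul])
    moreover have "p = snd p *\<^sub>R (0, 1)"
      using True by (simp add: prod_eq_iff)
    ultimately show ?thesis
      unfolding circuit_graph_eq by (metis convex_cone_hull_mul hull_inc insertI1)
  next
    case False
    then obtain lam k where "lam \<in> Lambda_X X A" "0 < k" "p = k *\<^sub>R funform X A lam"
      using extreme_ray_support_epigraph_circuit[OF nonempty finite_exponents assms p] by blast
    then show ?thesis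
      unfolding circuit_graph_eq
      using convex_cone_hull_mul[OF hull_inc] by (metis imageI insertI2 less_imp_le)
  qed
  then have "convex_cone hull {p. extreme_ray (epi \<beta>) p} \<subseteq> circuit_graph X A"
    by (intro hull_minimal) (auto simp: circuit_graph_eq convex_cone_convex_cone_hull)
  moreover have "salient (epi \<beta>)"
    using ex_strictly_positive_pairing_epi salient_if_linear_pos[OF linear_affine_pairing] assms by metis
  then have "convex_cone hull {p. extreme_ray (epi \<beta>) p} = epi \<beta>"
    using finitely_generated_cone_support_epigraph[OF polyhedron nonempty finite_exponents assms]
    by (simp add: convex_cone_hull_extreme_rays)
  ultimately show ?thesis by simp
qed

lemma circuit_graph_eq_hull_epi: "circuit_graph X A = convex_cone hull (\<Union>\<beta>\<in>A. epi \<beta>)"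
proof
  obtain \<beta> where "\<beta> \<in> A" using exponents_nonempty by blast
  moreover have "(0, 1) \<in> epi \<beta>"
    by (simp add: support_epigraph_def support_cone_def linear_0[OF linear_Amul]
        convex_cone_contains_0[OF convex_cone_Nbeta])
  moreover have "funform X A lam \<in> (\<Union>\<beta>\<in>A. epi \<beta>)" if "lam \<in> Lambda_X X A" for lam
    using funform_in_support_epigraph[OF nonempty that] by blast
  ultimately show "circuit_graph X A \<subseteq> convex_cone hull (\<Union>\<beta>\<in>A. epi \<beta>)"
    unfolding circuit_graph_eq by (intro hull_mono) auto
  show "convex_cone hull (\<Union>\<beta>\<in>A. epi \<beta>) \<subseteq> circuit_graph X A"
    using epi_subset_circuit_graph
    by (intro hull_minimal) (auto simp: circuit_graph_eq convex_cone_convex_cone_hull)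
qed

lemma finitely_generated_cone_circuit_graph: "finitely_generated_cone (circuit_graph X A)"
proof -
  have "\<forall>\<beta>\<in>A. \<exists>S. finite S \<and> epi \<beta> = convex_cone hull S"
    using finitely_generated_cone_support_epigraph[OF polyhedron nonempty finite_exponents]
    by (simp add: finitely_generated_cone_def)
  then obtain S where S: "\<And>\<beta>. \<beta> \<in> A \<Longrightarrow> finite (S \<beta>)" "\<And>\<beta>. \<beta> \<in> A \<Longrightarrow> epi \<beta> = convex_cone hull S \<beta>"
    by metis
  have "convex_cone hull (\<Union>\<beta>\<in>A. epi \<beta>) = convex_cone hull (\<Union>\<beta>\<in>A. S \<beta>)"
  proof
    have "epi \<beta> \<subseteq> convex_cone hull (\<Union>\<beta>\<in>A. S \<beta>)" if "\<beta> \<in> A" for \<beta>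
      unfolding S(2)[OF that] using that by (intro hull_mono) auto
    then show "convex_cone hull (\<Union>\<beta>\<in>A. epi \<beta>) \<subseteq> convex_cone hull (\<Union>\<beta>\<in>A. S \<beta>)"
      by (intro hull_minimal convex_cone_convex_cone_hull) auto
    show "convex_cone hull (\<Union>\<beta>\<in>A. S \<beta>) \<subseteq> convex_cone hull (\<Union>\<beta>\<in>A. epi \<beta>)"
      using S(2) by (intro hull_mono) (auto simp: hull_inc)
  qed
  then show ?thesis
    using S(1) finite_exponents by (simp add: circuit_graph_eq_hull_epi finitely_generated_cone_hull)
qed

lemma salient_circuit_graph: "salient (circuit_graph X A)"
proof -
  obtain y where y: "\<And>\<beta> p. \<beta> \<in> A \<Longrightarrow> p \<in> epi \<beta> \<Longrightarrow> p \<noteq> 0 \<Longrightarrow> 0 < pairing y p"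
    using ex_strictly_positive_pairing_epi by blast
  have "circuit_graph X A \<subseteq> {p. p = 0 \<or> 0 < pairing y p}"
    unfolding circuit_graph_eq_hull_epi using y
    by (intro hull_minimal convex_cone_zero_or_linear_pos linear_affine_pairing) auto
  then show ?thesis
    by (intro salient_if_linear_pos[OF linear_affine_pairing]) auto
qed

section \<open>Reduced circuits\<close>

lemma finite_Lambda_X_star: "finite (Lambda_X_star X A)"
proof (rule finite_imageD)
  have "(\<lambda>lam. ray (funform X A lam)) ` Lambda_X_star X A \<subseteq> ray ` {p. extreme_ray (circuit_graph X A) p}"
    by (auto simp: Lambda_X_star_def)
  then show "finite ((\<lambda>lam. ray (funform X A lam)) ` Lambda_X_star X A)"
    using finite_extreme_rays[OF finitely_generated_cone_circuit_graph] finite_subset by blast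
  show "inj_on (\<lambda>lam. ray (funform X A lam)) (Lambda_X_star X A)"
    using inj_on_ray_funform Lambda_X_star_subset by (rule inj_on_subset)
qed

lemma circuit_graph_eq_hull_reduced:
  "circuit_graph X A = convex_cone hull (insert (0, 1) (funform X A ` Lambda_X_star X A))" (is "_ = ?R")
proof
  show "?R \<subseteq> circuit_graph X A"
    unfolding circuit_graph_eq using Lambda_X_star_subset by (intro hull_mono) auto
  have "p \<in> ?R" if p: "extreme_ray (circuit_graph X A) p" for p
  proof -
    obtain s c where s: "s \<in> insert (0, 1) (funform X A ` Lambda_X X A)" "0 < c" "s = c *\<^sub>R p"
      using p extreme_ray_multiple_of_generator unfolding circuit_graph_eq by metis
    have "extreme_ray (circuit_graph X A) s"
      unfolding s(3) using p s(2)
      by (intro extreme_ray_scaleR) (simp_all add: circuit_graph_eq convex_cone_convex_cone_hull)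
    then have "s \<in> insert (0, 1) (funform X A ` Lambda_X_star X A)"
      using s(1) by (auto simp: Lambda_X_star_def)
    then have "(1 / c) *\<^sub>R s \<in> ?R"
      using s(2) by (intro convex_cone_hull_mul hull_inc) auto
    then show ?thesis using s(2,3) by simp
  qed
  then have "convex_cone hull {p. extreme_ray (circuit_graph X A) p} \<subseteq> ?R"
    by (intro hull_minimal convex_cone_convex_cone_hull) auto
  then show "circuit_graph X A \<subseteq> ?R"
    using convex_cone_hull_extreme_rays[OF finitely_generated_cone_circuit_graph salient_circuit_graph]
    by simp
qed

lemma Lambda_X_star_nonempty:
  assumes "Lambda_X X A \<noteq> {}"
  shows "Lambda_X_star X A \<noteq> {}"
proof
  assume "Lambda_X_star X A = {}"
  then have "circuit_graph X A \<subseteq> {p. fst p = 0}"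
    by (auto simp: circuit_graph_eq_hull_reduced convex_cone_hull_singleton)
  moreover obtain lam where lam: "lam \<in> Lambda_X X A" using assms by blast
  then have "funform X A lam \<in> circuit_graph X A"
    by (simp add: circuit_graph_eq hull_inc)
  ultimately have "lam = 0" by (auto simp: funform_eq)
  moreover obtain \<beta> where "lam \<beta> = - 1" using lam by (elim Lambda_XE)
  ultimately show False by simp
qed

lemma reduced_circuit_not_generated:
  assumes L: "L \<subseteq> Lambda_X_star X A" and lam: "lam \<in> Lambda_X_star X A" "lam \<notin> L"
  shows "funform X A lam \<notin> convex_cone hull (insert (0, 1) (funform X A ` L))" (is "_ \<notin> ?H")
proof
  assume "funform X A lam \<in> ?H"
  moreover have "?H \<subseteq> circuit_graph X A"
    unfolding circuit_graph_eq_hull_reduced using L by (intro hull_mono) auto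
  ultimately have "extreme_ray ?H (funform X A lam)"
    using lam(1) extreme_ray_subset unfolding Lambda_X_star_def by blast
  then obtain s c where s: "s \<in> insert (0, 1) (funform X A ` L)" "0 < c" "s = c *\<^sub>R funform X A lam"
    using extreme_ray_multiple_of_generator by metis
  have lam_Lambda: "lam \<in> Lambda_X X A" using lam(1) Lambda_X_star_subset by blast
  then obtain \<beta> where "lam \<beta> = -1" by (elim Lambda_XE)
  then have "lam \<noteq> 0" by auto
  then have "s \<noteq> (0, 1)" using s(2,3) by (auto simp: funform_eq)
  then obtain mu where mu: "mu \<in> L" "mu = c *\<^sub>R lam" using s(1,3) by (auto simp: funform_eq)
  then have "mu = lam"
    using L Lambda_X_star_subset s(2) by (intro Lambda_X_eq_if_multiple[OF lam_Lambda]) auto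
  then show False using mu(1) lam(2) by simp
qed

end

section \<open>Weighted geometric means\<close>

definition weighted_geo_mean :: "'i set \<Rightarrow> ('i \<Rightarrow> real) \<Rightarrow> ('i \<Rightarrow> real) \<Rightarrow> real" where
  "weighted_geo_mean I w x = (\<Prod>i\<in>I. x i powr w i)"

lemma weighted_geo_mean_eq_0:
  "finite I \<Longrightarrow> i \<in> I \<Longrightarrow> x i = 0 \<Longrightarrow> weighted_geo_mean I w x = 0"
  unfolding weighted_geo_mean_def by (rule prod_zero) auto

lemma weighted_geo_mean_eq_exp:
  assumes "finite I" "\<And>i. i \<in> I \<Longrightarrow> 0 < x i"
  shows "weighted_geo_mean I w x = exp (\<Sum>i\<in>I. w i * ln (x i))"
  unfolding weighted_geo_mean_def exp_sum[OF assms(1)]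
  using assms(2) by (intro prod.cong) (force simp: powr_def)+

lemma weighted_geo_mean_mult:
  "(\<And>i. i \<in> I \<Longrightarrow> 0 \<le> x i) \<Longrightarrow> (\<And>i. i \<in> I \<Longrightarrow> 0 \<le> y i) \<Longrightarrow>
    weighted_geo_mean I w (\<lambda>i. x i * y i) = weighted_geo_mean I w x * weighted_geo_mean I w y"
  by (simp add: weighted_geo_mean_def powr_mult prod.distrib)

lemma weighted_geo_mean_le_arith_mean:
  assumes "finite I" "\<And>i. i \<in> I \<Longrightarrow> 0 \<le> x i" "\<And>i. i \<in> I \<Longrightarrow> 0 \<le> w i" "(\<Sum>i\<in>I. w i) = 1"
  shows "weighted_geo_mean I w x \<le> (\<Sum>i\<in>I. w i * x i)"
proof (cases "\<exists>i\<in>I. x i = 0")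
  case True
  then have "weighted_geo_mean I w x = 0"
    using assms(1) weighted_geo_mean_eq_0 by metis
  then show ?thesis
    using assms(2,3) by (simp add: sum_nonneg)
next
  case False
  then have x_pos: "0 < x i" if "i \<in> I" for i
    using assms(2)[OF that] that by (auto simp: order_le_less)
  have "weighted_geo_mean I w x = exp (\<Sum>i\<in>I. w i *\<^sub>R ln (x i))"
    using assms(1) x_pos by (simp add: weighted_geo_mean_eq_exp)
  also have "\<dots> \<le> (\<Sum>i\<in>I. w i * exp (ln (x i)))"
    using assms by (intro convex_on_sum[OF _ _ exp_convex]) auto
  also have "\<dots> = (\<Sum>i\<in>I. w i * x i)"
    using x_pos by (intro sum.cong) auto
  finally show ?thesis .
qed

text \<open>Mahler's inequality: apply the arithmetic-geometric mean inequality to \<open>x / (x + y)\<close> and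
  \<open>y / (x + y)\<close>.\<close>

lemma weighted_geo_mean_superadditive:
  assumes "finite I" and nonneg: "\<And>i. i \<in> I \<Longrightarrow> 0 \<le> x i" "\<And>i. i \<in> I \<Longrightarrow> 0 \<le> y i"
    and w: "\<And>i. i \<in> I \<Longrightarrow> 0 \<le> w i" "(\<Sum>i\<in>I. w i) = 1"
  shows "weighted_geo_mean I w x + weighted_geo_mean I w y \<le> weighted_geo_mean I w (\<lambda>i. x i + y i)"
proof (cases "\<exists>i\<in>I. x i + y i = 0")
  case True
  then obtain i where "i \<in> I" "x i = 0" "y i = 0"
    using nonneg by (metis add_nonneg_eq_0_iff)
  then show ?thesis
    using assms(1) by (simp add: weighted_geo_mean_eq_0[of I i])
next
  case False
  define z where "z i = x i + y i" for i
  have z_pos: "0 < z i" if "i \<in> I" for i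
    using nonneg[OF that] False that by (auto simp: z_def order_le_less)
  have fraction: "weighted_geo_mean I w u \<le> weighted_geo_mean I w z * (\<Sum>i\<in>I. w i * (u i / z i))"
    if u: "\<And>i. i \<in> I \<Longrightarrow> 0 \<le> u i" for u
  proof -
    have "weighted_geo_mean I w u = weighted_geo_mean I w (\<lambda>i. z i * (u i / z i))"
      unfolding weighted_geo_mean_def using z_pos by (intro prod.cong) force+
    also have "\<dots> = weighted_geo_mean I w z * weighted_geo_mean I w (\<lambda>i. u i / z i)"
      using u z_pos by (intro weighted_geo_mean_mult) (auto simp: less_imp_le)
    also have "\<dots> \<le> weighted_geo_mean I w z * (\<Sum>i\<in>I. w i * (u i / z i))"
      using assms(1) w u z_pos
      by (intro mult_left_mono weighted_geo_mean_le_arith_mean)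
        (auto simp: weighted_geo_mean_def prod_nonneg less_imp_le)
    finally show ?thesis .
  qed
  have "(\<Sum>i\<in>I. w i * (x i / z i)) + (\<Sum>i\<in>I. w i * (y i / z i)) = (\<Sum>i\<in>I. w i)"
    unfolding sum.distrib[symmetric] using z_pos
    by (intro sum.cong) (force simp: z_def simp flip: distrib_left add_divide_distrib)+
  then have total: "weighted_geo_mean I w z * (\<Sum>i\<in>I. w i * (x i / z i)) +
      weighted_geo_mean I w z * (\<Sum>i\<in>I. w i * (y i / z i)) = weighted_geo_mean I w z"
    by (simp add: w(2) flip: distrib_left)
  show ?thesis
    using add_mono[OF fraction fraction, of x y, unfolded total] nonneg by (simp add: z_def[abs_def])
qed

section \<open>Cones of witnessed AGE signomials\<close>

locale normalized_witness =
  fixes A :: "'a::euclidean_space set" and \<beta> :: 'a and lam :: "'a \<Rightarrow> real"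
  assumes finite_exponents: "finite A" and negative_index: "\<beta> \<in> A"
    and in_Nbeta: "lam \<in> Nbeta A \<beta>" and normalized: "lam \<beta> = - 1"
begin

definition positive_support :: "'a set" where
  "positive_support = {\<alpha>\<in>A. 0 < lam \<alpha>}"

lemma positive_support: "finite positive_support" "positive_support \<subseteq> A - {\<beta>}"
  using finite_exponents normalized by (auto simp: positive_support_def)

lemma positive_supportD: "\<alpha> \<in> positive_support \<Longrightarrow> 0 < lam \<alpha>"
  by (simp add: positive_support_def)

lemma nonneg: "\<alpha> \<in> A - {\<beta>} \<Longrightarrow> 0 \<le> lam \<alpha>"
  using in_Nbeta by (simp add: Nbeta_def)

lemma inner_on_witness: "inner_on A lam f = (\<Sum>\<alpha>\<in>positive_support. lam \<alpha> * f \<alpha>) - f \<beta>"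
proof -
  have "(\<Sum>\<alpha>\<in>A - {\<beta>}. lam \<alpha> * f \<alpha>) = (\<Sum>\<alpha>\<in>positive_support. lam \<alpha> * f \<alpha>)"
    using positive_support finite_exponents nonneg
    by (intro sum.mono_neutral_right) (auto simp: positive_support_def order_le_less)
  then show ?thesis
    using finite_exponents negative_index normalized by (simp add: inner_on_def sum.remove)
qed

lemma sum_positive_support: "(\<Sum>\<alpha>\<in>positive_support. lam \<alpha>) = 1"
  using inner_on_witness[of "\<lambda>_. 1"] in_Nbeta by (simp add: inner_on_def Nbeta_def)

lemma neg_idx_eq: "neg_idx A lam = \<beta>"
  unfolding neg_idx_def
  using negative_index normalized nonneg by (intro the_equality) (auto simp: not_less[symmetric])

definition normalized_geo_mean :: "('a \<Rightarrow> real) \<Rightarrow> real" where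
  "normalized_geo_mean c = weighted_geo_mean positive_support lam (\<lambda>\<alpha>. c \<alpha> / lam \<alpha>)"

lemma AGE_lambda_iff: "c \<in> AGE_lambda X A lam \<longleftrightarrow>
    in_RA A c \<and> (\<forall>\<alpha>\<in>A - {\<beta>}. 0 \<le> c \<alpha>) \<and> - c \<beta> * exp (support_value X A lam) \<le> normalized_geo_mean c"
  unfolding AGE_lambda_def neg_idx_eq
  by (auto simp: normalized_geo_mean_def weighted_geo_mean_def positive_support_def support_value_def)

lemma AGE_lambda_nonneg: "c \<in> AGE_lambda X A lam \<Longrightarrow> \<alpha> \<in> A - {\<beta>} \<Longrightarrow> 0 \<le> c \<alpha>"
  by (simp add: AGE_lambda_iff)

lemma nonneg_in_AGE_lambda:
  assumes "in_RA A c" "\<And>\<alpha>. \<alpha> \<in> A \<Longrightarrow> 0 \<le> c \<alpha>"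
  shows "c \<in> AGE_lambda X A lam"
proof -
  have "- c \<beta> * exp (support_value X A lam) \<le> 0"
    using assms(2)[OF negative_index] by simp
  also have "0 \<le> normalized_geo_mean c"
    by (simp add: normalized_geo_mean_def weighted_geo_mean_def prod_nonneg)
  finally show ?thesis
    using assms by (simp add: AGE_lambda_iff)
qed

lemma normalized_geo_mean_add:
  assumes "\<And>\<alpha>. \<alpha> \<in> A - {\<beta>} \<Longrightarrow> 0 \<le> c \<alpha>" "\<And>\<alpha>. \<alpha> \<in> A - {\<beta>} \<Longrightarrow> 0 \<le> d \<alpha>"
  shows "normalized_geo_mean c + normalized_geo_mean d \<le> normalized_geo_mean (c + d)"
  unfolding normalized_geo_mean_def plus_fun_apply add_divide_distrib
  using assms positive_support positive_supportD
  by (intro weighted_geo_mean_superadditive sum_positive_support) (auto simp: subset_iff less_imp_le)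

lemma normalized_geo_mean_scaleR:
  assumes "\<And>\<alpha>. \<alpha> \<in> A - {\<beta>} \<Longrightarrow> 0 \<le> c \<alpha>" "0 \<le> k"
  shows "normalized_geo_mean (k *\<^sub>R c) = k * normalized_geo_mean c"
proof -
  have "normalized_geo_mean (k *\<^sub>R c) = weighted_geo_mean positive_support lam (\<lambda>_. k) * normalized_geo_mean c"
    unfolding normalized_geo_mean_def using assms positive_support positive_supportD
    by (subst weighted_geo_mean_mult[symmetric]) (auto simp: subset_iff less_imp_le)
  also have "weighted_geo_mean positive_support lam (\<lambda>_. k) = k"
  proof (cases "k = 0")
    case True
    have "positive_support \<noteq> {}" using sum_positive_support by force
    then show ?thesis
      using True positive_support(1) weighted_geo_mean_eq_0 by (metis all_not_in_conv)
  next
    case False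
    then show ?thesis
      using assms(2) by (simp add: weighted_geo_mean_def sum_positive_support flip: powr_sum)
  qed
  finally show ?thesis .
qed

lemma convex_cone_AGE_lambda: "convex_cone (AGE_lambda X A lam)"
  unfolding convex_cone_iff
proof (intro conjI ballI allI impI)
  show "0 \<in> AGE_lambda X A lam"
    by (rule nonneg_in_AGE_lambda) (auto simp: in_RA_def)
  show "c + d \<in> AGE_lambda X A lam" if "c \<in> AGE_lambda X A lam" "d \<in> AGE_lambda X A lam" for c d
    using that normalized_geo_mean_add[of c d] by (auto simp: AGE_lambda_iff in_RA_def algebra_simps)
  show "k *\<^sub>R c \<in> AGE_lambda X A lam" if "c \<in> AGE_lambda X A lam" "0 \<le> k" for c k
  proof -
    have "k * (- c \<beta> * exp (support_value X A lam)) \<le> k * normalized_geo_mean c"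
      using that by (intro mult_left_mono) (auto simp: AGE_lambda_iff)
    then show ?thesis
      using that normalized_geo_mean_scaleR[of c k] by (auto simp: AGE_lambda_iff in_RA_def)
  qed
qed

lemma closed_AGE_lambda: "closed (AGE_lambda X A lam)"
proof -
  let ?S = "{c. in_RA A c \<and> (\<forall>\<alpha>\<in>A - {\<beta>}. 0 \<le> c \<alpha>)}"
  have "closed {c :: 'a \<Rightarrow> real. c \<alpha> = 0}" "closed {c :: 'a \<Rightarrow> real. 0 \<le> c \<alpha>}" for \<alpha>
    by (intro closed_Collect_eq closed_Collect_le continuous_on_apply continuous_on_const)+
  then have "closed ?S"
    unfolding in_RA_def Ball_def
    by (intro closed_Collect_conj closed_Collect_all closed_Collect_imp open_Collect_const)
  moreover have "continuous_on ?S (\<lambda>c. (c \<alpha> / lam \<alpha>) powr lam \<alpha>)" if "\<alpha> \<in> positive_support" for \<alpha>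
  proof -
    have "\<alpha> \<in> A - {\<beta>}" "0 < lam \<alpha>"
      using that positive_support(2) positive_supportD by blast+
    then show ?thesis
      by (intro continuous_on_powr' continuous_on_divide[OF continuous_on_apply] continuous_on_const)
        auto
  qed
  then have "continuous_on ?S (\<lambda>c. normalized_geo_mean c + c \<beta> * exp (support_value X A lam))"
    unfolding normalized_geo_mean_def weighted_geo_mean_def
    by (intro continuous_on_add continuous_on_mult_right continuous_on_prod continuous_on_apply)
  ultimately have "closed (?S \<inter> (\<lambda>c. normalized_geo_mean c + c \<beta> * exp (support_value X A lam)) -` {0..})"
    by (intro continuous_closed_preimage closed_atLeast)
  also have "?S \<inter> (\<lambda>c. normalized_geo_mean c + c \<beta> * exp (support_value X A lam)) -` {0..} = AGE_lambda X A lam"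
    by (auto simp: AGE_lambda_iff)
  finally show ?thesis .
qed

lemma AGE_lambda_bound:
  assumes c: "c \<in> AGE_lambda X A lam"
  shows "- c \<beta> * exp (y \<beta>)
    \<le> exp (- affine_pairing A y (funform X A lam)) * (\<Sum>\<alpha>\<in>A - {\<beta>}. c \<alpha> * exp (y \<alpha>))"
proof -
  define s where "s = (\<Sum>\<alpha>\<in>positive_support. lam \<alpha> * y \<alpha>)"
  have weights: "0 < lam \<alpha>" "0 \<le> c \<alpha>" if "\<alpha> \<in> positive_support" for \<alpha>
    using that positive_supportD positive_support(2) AGE_lambda_nonneg[OF c] by blast+
  have "normalized_geo_mean c * exp s
      = weighted_geo_mean positive_support lam (\<lambda>\<alpha>. c \<alpha> / lam \<alpha> * exp (y \<alpha>))"
    unfolding normalized_geo_mean_def s_def using weights positive_support(1)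
    by (subst weighted_geo_mean_mult) (auto simp: weighted_geo_mean_eq_exp less_imp_le)
  also have "\<dots> \<le> (\<Sum>\<alpha>\<in>positive_support. lam \<alpha> * (c \<alpha> / lam \<alpha> * exp (y \<alpha>)))"
    using weights positive_support(1) sum_positive_support
    by (intro weighted_geo_mean_le_arith_mean) (auto simp: less_imp_le)
  also have "\<dots> = (\<Sum>\<alpha>\<in>positive_support. c \<alpha> * exp (y \<alpha>))"
    using weights(1) by (intro sum.cong) fastforce+
  also have "\<dots> \<le> (\<Sum>\<alpha>\<in>A - {\<beta>}. c \<alpha> * exp (y \<alpha>))"
    using finite_exponents positive_support(2) AGE_lambda_nonneg[OF c] by (intro sum_mono2) auto
  finally have amgm: "normalized_geo_mean c * exp s \<le> (\<Sum>\<alpha>\<in>A - {\<beta>}. c \<alpha> * exp (y \<alpha>))" .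
  have "- c \<beta> * exp (y \<beta>) = (- c \<beta> * exp (support_value X A lam)) * exp (y \<beta> - support_value X A lam)"
    by (simp add: exp_diff)
  also have "\<dots> \<le> normalized_geo_mean c * exp (y \<beta> - support_value X A lam)"
    using c by (intro mult_right_mono) (auto simp: AGE_lambda_iff)
  also have "\<dots> = exp (- affine_pairing A y (funform X A lam)) * (normalized_geo_mean c * exp s)"
    by (simp add: affine_pairing_def funform_eq inner_on_witness s_def exp_diff exp_minus exp_add
        field_simps)
  also have "\<dots> \<le> exp (- affine_pairing A y (funform X A lam)) * (\<Sum>\<alpha>\<in>A - {\<beta>}. c \<alpha> * exp (y \<alpha>))"
    using amgm by (intro mult_left_mono) auto
  finally show ?thesis .
qed

lemma inner_on_remove: "inner_on A c f = c \<beta> * f \<beta> + (\<Sum>\<alpha>\<in>A - {\<beta>}. c \<alpha> * f \<alpha>)"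
  using finite_exponents negative_index by (simp add: inner_on_def sum.remove)

lemma AGE_lambda_exp_nonneg:
  assumes c: "c \<in> AGE_lambda X A lam" and y: "0 \<le> affine_pairing A y (funform X A lam)"
  shows "0 \<le> inner_on A c (\<lambda>\<alpha>. exp (y \<alpha>))"
proof -
  have "0 \<le> (\<Sum>\<alpha>\<in>A - {\<beta>}. c \<alpha> * exp (y \<alpha>))"
    using AGE_lambda_nonneg[OF c] by (intro sum_nonneg) auto
  then have "- c \<beta> * exp (y \<beta>) \<le> (\<Sum>\<alpha>\<in>A - {\<beta>}. c \<alpha> * exp (y \<alpha>))"
    using y by (intro order_trans[OF AGE_lambda_bound[OF c] mult_left_le_one_le]) auto
  then show ?thesis by (simp add: inner_on_remove)
qed

lemma AGE_lambda_exp_pos: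
  assumes c: "c \<in> AGE_lambda X A lam" "c \<noteq> 0" and y: "0 < affine_pairing A y (funform X A lam)"
  shows "0 < inner_on A c (\<lambda>\<alpha>. exp (y \<alpha>))"
proof (cases "\<exists>\<alpha>\<in>A - {\<beta>}. c \<alpha> \<noteq> 0")
  case True
  then obtain \<alpha> where \<alpha>: "\<alpha> \<in> A - {\<beta>}" "0 < c \<alpha>"
    using AGE_lambda_nonneg[OF c(1)] by (metis order_le_less)
  then have "0 < (\<Sum>\<alpha>\<in>A - {\<beta>}. c \<alpha> * exp (y \<alpha>))"
    using AGE_lambda_nonneg[OF c(1)] finite_exponents by (intro sum_pos2[of _ \<alpha>]) auto
  then have "- c \<beta> * exp (y \<beta>) < (\<Sum>\<alpha>\<in>A - {\<beta>}. c \<alpha> * exp (y \<alpha>))"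
    using y by (intro le_less_trans[OF AGE_lambda_bound[OF c(1)]]) simp
  then show ?thesis by (simp add: inner_on_remove)
next
  case False
  then have rest: "(\<Sum>\<alpha>\<in>A - {\<beta>}. c \<alpha> * f \<alpha>) = 0" for f
    by (intro sum.neutral) simp
  have "c \<beta> \<noteq> 0"
    using False c(2) in_RA_eqI[of A c 0] c(1) by (fastforce simp: AGE_lambda_iff in_RA_def)
  moreover have "0 \<le> c \<beta>"
    using AGE_lambda_bound[OF c(1), of y] rest by (simp add: zero_le_mult_iff)
  ultimately show ?thesis by (simp add: inner_on_remove rest)
qed

text \<open>The test coefficients are the equality case of the arithmetic-geometric mean inequality.\<close>

lemma affine_pairing_nonneg_if_AGE_lambda_exp_nonneg:
  assumes "\<And>c. c \<in> AGE_lambda X A lam \<Longrightarrow> 0 \<le> inner_on A c (\<lambda>\<alpha>. exp (y \<alpha>))"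
  shows "0 \<le> affine_pairing A y (funform X A lam)"
proof -
  define s where "s = (\<Sum>\<alpha>\<in>positive_support. lam \<alpha> * y \<alpha>)"
  define c where "c \<alpha> = (if \<alpha> = \<beta> then - exp (- s - support_value X A lam) else lam \<alpha> * exp (- y \<alpha>))" for \<alpha>
  have "normalized_geo_mean c = weighted_geo_mean positive_support lam (\<lambda>\<alpha>. exp (- y \<alpha>))"
    unfolding normalized_geo_mean_def weighted_geo_mean_def using positive_support(2) positive_supportD
    by (intro prod.cong) (fastforce simp: c_def)+
  also have "\<dots> = exp (- s)"
    using positive_support(1) by (simp add: weighted_geo_mean_eq_exp s_def sum_negf)
  finally have "normalized_geo_mean c = - c \<beta> * exp (support_value X A lam)"
    by (simp add: c_def exp_diff)
  moreover have "in_RA A c"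
    using in_Nbeta negative_index by (auto simp: c_def in_RA_def Nbeta_def)
  ultimately have "c \<in> AGE_lambda X A lam"
    using nonneg by (auto simp: AGE_lambda_iff c_def)
  then have "0 \<le> inner_on A c (\<lambda>\<alpha>. exp (y \<alpha>))" by (rule assms)
  also have "\<dots> = c \<beta> * exp (y \<beta>) + (\<Sum>\<alpha>\<in>A - {\<beta>}. lam \<alpha>)"
    unfolding inner_on_remove
    by (intro arg_cong2[of _ _ _ _ "(+)"] refl sum.cong) (auto simp: c_def exp_minus)
  also have "(\<Sum>\<alpha>\<in>A - {\<beta>}. lam \<alpha>) = 1"
    using in_Nbeta normalized finite_exponents negative_index by (simp add: Nbeta_def sum.remove)
  also have "c \<beta> * exp (y \<beta>) = - exp (- affine_pairing A y (funform X A lam))"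
    unfolding affine_pairing_def funform_eq fst_conv snd_conv inner_on_witness s_def[symmetric]
    by (simp add: c_def flip: exp_add)
  finally show ?thesis by simp
qed

lemma AGE_lambda_exp_nonneg_iff:
  "(\<forall>c\<in>AGE_lambda X A lam. 0 \<le> inner_on A c (\<lambda>\<alpha>. exp (y \<alpha>))) \<longleftrightarrow>
    0 \<le> affine_pairing A y (funform X A lam)"
  using AGE_lambda_exp_nonneg affine_pairing_nonneg_if_AGE_lambda_exp_nonneg by blast

end

section \<open>Separation by exponentials\<close>

lemma exp_separation:
  assumes "finite A" "closed C" "convex_cone C" and RA: "\<And>s. s \<in> C \<Longrightarrow> in_RA A s"
    and unit: "\<And>\<alpha>. \<alpha> \<in> A \<Longrightarrow> indicat_real {\<alpha>} \<in> C"
    and u: "\<And>s. s \<in> C \<Longrightarrow> 0 \<le> inner_on A s (\<lambda>\<alpha>. exp (u \<alpha>))"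
    and c: "in_RA A c" "c \<notin> C"
  obtains y where "\<And>s. s \<in> C \<Longrightarrow> 0 \<le> inner_on A s (\<lambda>\<alpha>. exp (y \<alpha>))"
    "inner_on A c (\<lambda>\<alpha>. exp (y \<alpha>)) < 0"
proof -
  obtain v where v: "\<And>s. s \<in> C \<Longrightarrow> 0 \<le> inner_on A s v" "inner_on A c v < 0"
    using closed_convex_cone_separation[OF assms(1-3) RA c] by blast
  have v_nonneg: "0 \<le> v \<alpha>" if "\<alpha> \<in> A" for \<alpha>
    using v(1)[OF unit[OF that]] that assms(1) by (simp add: inner_on_indicator)
  obtain \<epsilon> where \<epsilon>: "0 < \<epsilon>" "inner_on A c v + \<epsilon> * inner_on A c (\<lambda>\<alpha>. exp (u \<alpha>)) < 0"
    using negative_perturbation[OF v(2)] by blast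
  define y where "y \<alpha> = ln (v \<alpha> + \<epsilon> * exp (u \<alpha>))" for \<alpha>
  have "exp (y \<alpha>) = v \<alpha> + \<epsilon> * exp (u \<alpha>)" if "\<alpha> \<in> A" for \<alpha>
    unfolding y_def using v_nonneg[OF that] \<epsilon>(1) by (intro exp_ln add_nonneg_pos) auto
  then have inner_exp_y: "inner_on A s (\<lambda>\<alpha>. exp (y \<alpha>)) =
      inner_on A s v + \<epsilon> * inner_on A s (\<lambda>\<alpha>. exp (u \<alpha>))" for s
    by (simp add: inner_on_def distrib_left sum.distrib sum_distrib_left mult.left_commute)
  show thesis
    using v(1) u \<epsilon> by (intro that[of y]) (simp_all add: inner_exp_y)
qed

section \<open>The decomposition into reduced circuits\<close>

lemma signomial_eq: "signomial A c x = inner_on A c (\<lambda>\<alpha>. exp (\<alpha> \<bullet> x))"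
  by (simp add: signomial_def inner_on_def)

lemma convex_cone_SAGE_beta: "convex_cone (SAGE_beta X A \<beta>)"
  by (auto simp: convex_cone_iff SAGE_beta_def in_RA_def signomial_eq inner_on_add_left
      inner_on_scaleR_left inner_on_zero_left)

lemma zero_in_SAGE_beta: "0 \<in> SAGE_beta X A \<beta>"
  by (rule convex_cone_contains_0[OF convex_cone_SAGE_beta])

context signomial_cones
begin

lemma normalized_witness_Lambda_X:
  assumes "lam \<in> Lambda_X X A"
  obtains \<beta> where "normalized_witness A \<beta> lam"
  using assms finite_exponents by (elim Lambda_XE) (auto simp: normalized_witness_def)

lemma AGE_lambda_exp_nonneg_iff:
  assumes "lam \<in> Lambda_X X A"
  shows "(\<forall>c\<in>AGE_lambda X A lam. 0 \<le> inner_on A c (\<lambda>\<alpha>. exp (y \<alpha>))) \<longleftrightarrow>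
    0 \<le> pairing y (funform X A lam)"
proof -
  obtain \<beta> where "normalized_witness A \<beta> lam"
    using normalized_witness_Lambda_X[OF assms] by blast
  then show ?thesis
    by (rule normalized_witness.AGE_lambda_exp_nonneg_iff)
qed

lemma msum_AGE_lambda_exp_nonneg:
  assumes "L \<subseteq> Lambda_X X A" "\<And>lam. lam \<in> L \<Longrightarrow> 0 \<le> pairing y (funform X A lam)"
    and "s \<in> msum L (AGE_lambda X A)"
  shows "0 \<le> inner_on A s (\<lambda>\<alpha>. exp (y \<alpha>))"
proof -
  have "msum L (AGE_lambda X A) \<subseteq> {s. 0 \<le> inner_on A s (\<lambda>\<alpha>. exp (y \<alpha>))}"
    using assms(1,2) AGE_lambda_exp_nonneg_iff
    by (intro msum_subset_convex_cone convex_cone_linear_nonneg linear_inner_on) blast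
  then show ?thesis using assms(3) by blast
qed

lemma pairing_point_nonneg:
  assumes "x \<in> X" "lam \<in> Lambda_X X A"
  shows "0 \<le> pairing (\<lambda>\<alpha>. \<alpha> \<bullet> x) (funform X A lam)"
proof -
  obtain \<beta> where "funform X A lam \<in> epi \<beta>"
    using funform_in_support_epigraph[OF nonempty assms(2)] by blast
  then show ?thesis
    using assms(1)
    by (auto simp: support_epigraph_def support_cone_def affine_pairing_def funform_eq inner_Amul)
qed

lemma AGE_lambda_subset_SAGE:
  assumes "lam \<in> Lambda_X X A"
  shows "AGE_lambda X A lam \<subseteq> SAGE X A"
proof -
  obtain \<beta> where w: "normalized_witness A \<beta> lam"
    using normalized_witness_Lambda_X[OF assms] by blast
  have "0 \<le> signomial A c x" if "c \<in> AGE_lambda X A lam" "x \<in> X" for c x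
    using that pairing_point_nonneg[OF that(2) assms]
    by (simp add: signomial_eq normalized_witness.AGE_lambda_exp_nonneg[OF w])
  then have "AGE_lambda X A lam \<subseteq> SAGE_beta X A \<beta>"
    by (auto simp: SAGE_beta_def normalized_witness.AGE_lambda_iff[OF w])
  also have "\<dots> \<subseteq> SAGE X A"
    unfolding SAGE_def using finite_exponents normalized_witness.negative_index[OF w] zero_in_SAGE_beta
    by (rule subset_msum)
  finally show ?thesis .
qed

lemma convex_cone_AGE_lambda: "lam \<in> Lambda_X X A \<Longrightarrow> convex_cone (AGE_lambda X A lam)"
  using normalized_witness_Lambda_X normalized_witness.convex_cone_AGE_lambda by metis

abbreviation reduced_sum :: "('a \<Rightarrow> real) set" where
  "reduced_sum \<equiv> msum (Lambda_X_star X A) (AGE_lambda X A)"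

lemma convex_cone_reduced_sum: "convex_cone reduced_sum"
  using convex_cone_AGE_lambda Lambda_X_star_subset by (intro convex_cone_msum) blast

lemma in_RA_reduced_sum: "c \<in> reduced_sum \<Longrightarrow> in_RA A c"
  by (auto simp: msum_def in_RA_def AGE_lambda_def)

end

context polyhedral_signomial_cones
begin

lemma AGE_lambda_subset_reduced_sum:
  "lam \<in> Lambda_X_star X A \<Longrightarrow> AGE_lambda X A lam \<subseteq> reduced_sum"
  using finite_Lambda_X_star convex_cone_AGE_lambda Lambda_X_star_subset convex_cone_contains_0
  by (intro subset_msum) blast+

lemma closed_reduced_sum: "closed reduced_sum"
proof -
  obtain y where y: "\<And>\<beta> p. \<beta> \<in> A \<Longrightarrow> p \<in> epi \<beta> \<Longrightarrow> p \<noteq> 0 \<Longrightarrow> 0 < pairing y p"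
    using ex_strictly_positive_pairing_epi by blast
  show ?thesis
  proof (rule closed_msum[OF finite_exponents finite_Lambda_X_star, where v = "\<lambda>\<alpha>. exp (y \<alpha>)"])
    fix lam assume "lam \<in> Lambda_X_star X A"
    then have lam: "lam \<in> Lambda_X X A" using Lambda_X_star_subset by blast
    then obtain \<beta> where w: "normalized_witness A \<beta> lam"
      using normalized_witness_Lambda_X by blast
    show "closed (AGE_lambda X A lam)"
      by (rule normalized_witness.closed_AGE_lambda[OF w])
    show "convex_cone (AGE_lambda X A lam)"
      by (rule normalized_witness.convex_cone_AGE_lambda[OF w])
    show "in_RA A c" if "c \<in> AGE_lambda X A lam" for c
      using that by (simp add: AGE_lambda_def)
    have "funform X A lam \<noteq> 0"
      using normalized_witness.normalized[OF w] by (auto simp: funform_eq zero_prod_def)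
    then have "0 < pairing y (funform X A lam)"
      using y funform_in_support_epigraph[OF nonempty lam] by metis
    then show "0 < inner_on A c (\<lambda>\<alpha>. exp (y \<alpha>))" if "c \<in> AGE_lambda X A lam" "c \<noteq> 0" for c
      using that by (intro normalized_witness.AGE_lambda_exp_pos[OF w])
  qed
qed

lemma SAGE_beta_exp_nonneg:
  assumes \<beta>: "\<beta> \<in> A" and c: "c \<in> SAGE_beta X A \<beta>" and y: "\<And>p. p \<in> epi \<beta> \<Longrightarrow> 0 \<le> pairing y p"
  shows "0 \<le> inner_on A c (\<lambda>\<alpha>. exp (y \<alpha>))"
proof -
  obtain x where x: "x \<in> X" "\<And>\<alpha>. \<alpha> \<in> A \<Longrightarrow> (\<alpha> - \<beta>) \<bullet> x \<le> y \<alpha> - y \<beta>"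
    using ex_point_below[OF polyhedron finite_exponents \<beta> y] by blast
  have "0 \<le> exp (y \<beta> - \<beta> \<bullet> x) * signomial A c x"
    using c x(1) by (simp add: SAGE_beta_def)
  also have "\<dots> = (\<Sum>\<alpha>\<in>A. c \<alpha> * exp ((\<alpha> - \<beta>) \<bullet> x + y \<beta>))"
    by (simp add: signomial_def sum_distrib_left inner_diff_left exp_add exp_diff field_simps)
  also have "\<dots> \<le> inner_on A c (\<lambda>\<alpha>. exp (y \<alpha>))"
    unfolding inner_on_def
  proof (rule sum_mono)
    fix \<alpha> assume \<alpha>: "\<alpha> \<in> A"
    show "c \<alpha> * exp ((\<alpha> - \<beta>) \<bullet> x + y \<beta>) \<le> c \<alpha> * exp (y \<alpha>)"
    proof (cases "\<alpha> = \<beta>")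
      case False
      then show ?thesis
        using c \<alpha> x(2)[OF \<alpha>] by (intro mult_left_mono) (auto simp: SAGE_beta_def)
    qed simp
  qed
  finally show ?thesis .
qed

lemma pairing_circuit_graph_nonneg:
  assumes "\<And>lam. lam \<in> Lambda_X_star X A \<Longrightarrow> 0 \<le> pairing y (funform X A lam)" "p \<in> circuit_graph X A"
  shows "0 \<le> pairing y p"
  using assms unfolding circuit_graph_eq_hull_reduced
  by (elim convex_cone_hull_nonneg[OF linear_affine_pairing])
    (auto simp: affine_pairing_def inner_on_zero_left)

lemma indicator_in_reduced_sum:
  assumes "Lambda_X X A \<noteq> {}" "\<alpha> \<in> A"
  shows "indicat_real {\<alpha>} \<in> reduced_sum"
proof -
  obtain lam where lam: "lam \<in> Lambda_X_star X A"
    using Lambda_X_star_nonempty[OF assms(1)] by blast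
  then obtain \<gamma> where "normalized_witness A \<gamma> lam"
    using normalized_witness_Lambda_X Lambda_X_star_subset by blast
  then have "indicat_real {\<alpha>} \<in> AGE_lambda X A lam"
    using assms(2)
    by (intro normalized_witness.nonneg_in_AGE_lambda) (auto simp: in_RA_def indicator_def)
  then show ?thesis
    using AGE_lambda_subset_reduced_sum[OF lam] by blast
qed

lemma SAGE_beta_subset_reduced_sum:
  assumes "Lambda_X X A \<noteq> {}" and \<beta>: "\<beta> \<in> A"
  shows "SAGE_beta X A \<beta> \<subseteq> reduced_sum"
proof (rule ccontr)
  assume "\<not> SAGE_beta X A \<beta> \<subseteq> reduced_sum"
  then obtain c where c: "c \<in> SAGE_beta X A \<beta>" "c \<notin> reduced_sum" by blast
  obtain x where x: "x \<in> X" using nonempty by blast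
  obtain y where y: "\<And>s. s \<in> reduced_sum \<Longrightarrow> 0 \<le> inner_on A s (\<lambda>\<alpha>. exp (y \<alpha>))"
      "inner_on A c (\<lambda>\<alpha>. exp (y \<alpha>)) < 0"
  proof (rule exp_separation[OF finite_exponents closed_reduced_sum convex_cone_reduced_sum in_RA_reduced_sum
        indicator_in_reduced_sum[OF assms(1)]])
    show "0 \<le> inner_on A s (\<lambda>\<alpha>. exp (\<alpha> \<bullet> x))" if "s \<in> reduced_sum" for s
      using that Lambda_X_star_subset pairing_point_nonneg[OF x]
      by (intro msum_AGE_lambda_exp_nonneg[of "Lambda_X_star X A"]) auto
  qed (use c in \<open>auto simp: SAGE_beta_def\<close>)
  have "0 \<le> pairing y (funform X A lam)" if "lam \<in> Lambda_X_star X A" for lam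
  proof -
    have "lam \<in> Lambda_X X A" using that Lambda_X_star_subset by blast
    then show ?thesis
      using y(1) AGE_lambda_subset_reduced_sum[OF that] AGE_lambda_exp_nonneg_iff by blast
  qed
  then have "0 \<le> inner_on A c (\<lambda>\<alpha>. exp (y \<alpha>))"
    using \<beta> c(1) pairing_circuit_graph_nonneg epi_subset_circuit_graph
    by (intro SAGE_beta_exp_nonneg) blast+
  then show False using y(2) by simp
qed

lemma SAGE_eq_reduced_sum:
  assumes "Lambda_X X A \<noteq> {}"
  shows "SAGE X A = reduced_sum"
proof
  show "SAGE X A \<subseteq> reduced_sum"
    unfolding SAGE_def using SAGE_beta_subset_reduced_sum[OF assms]
    by (intro msum_subset_convex_cone convex_cone_reduced_sum)
  have "convex_cone (SAGE X A)"
    unfolding SAGE_def by (intro convex_cone_msum convex_cone_SAGE_beta)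
  then show "reduced_sum \<subseteq> SAGE X A"
    using AGE_lambda_subset_SAGE Lambda_X_star_subset by (intro msum_subset_convex_cone) blast+
qed

lemma SAGE_neq_proper_msum:
  assumes "L \<subset> Lambda_X_star X A"
  shows "SAGE X A \<noteq> msum L (AGE_lambda X A)"
proof
  assume eq: "SAGE X A = msum L (AGE_lambda X A)"
  obtain lam where lam: "lam \<in> Lambda_X_star X A" "lam \<notin> L" using assms by blast
  have lam_Lambda: "lam \<in> Lambda_X X A" and L: "L \<subseteq> Lambda_X X A"
    using lam assms Lambda_X_star_subset by blast+
  obtain x where x: "x \<in> X" using nonempty by blast
  have RA: "in_RA A (fst (funform X A mu))" if "mu \<in> Lambda_X X A" for mu
    using that by (elim Lambda_XE) (simp add: funform_eq Nbeta_def)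
  obtain y where y: "\<And>s. s \<in> funform X A ` L \<Longrightarrow> 0 \<le> pairing y s" "pairing y (funform X A lam) < 0"
  proof (rule affine_pairing_separation[OF finite_exponents])
    show "finite (funform X A ` L)"
      using assms finite_Lambda_X_star finite_subset by blast
    show "funform X A lam \<notin> convex_cone hull (insert (0, 1) (funform X A ` L))"
      using assms lam by (intro reduced_circuit_not_generated) auto
    show "0 \<le> pairing (\<lambda>\<alpha>. \<alpha> \<bullet> x) s" if "s \<in> funform X A ` L" for s
      using that L pairing_point_nonneg[OF x] by blast
  qed (use RA L lam_Lambda in blast)+
  have "0 \<le> inner_on A c (\<lambda>\<alpha>. exp (y \<alpha>))" if "c \<in> AGE_lambda X A lam" for c
    using that AGE_lambda_subset_SAGE[OF lam_Lambda] eq y(1)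
    by (intro msum_AGE_lambda_exp_nonneg[OF L]) auto
  then have "0 \<le> pairing y (funform X A lam)"
    using AGE_lambda_exp_nonneg_iff[OF lam_Lambda] by blast
  then show False using y(2) by simp
qed

end

theorem theorem5p6:
  fixes X :: "'a::euclidean_space set" and A :: "'a set"
  assumes "polyhedron X" and "X \<noteq> {}"
    and "finite A" and "A \<noteq> {}"
    and "exp_lin_indep_on X A"
    and "Lambda_X X A \<noteq> {}"
  shows "finite (Lambda_X_star X A) \<and>
         SAGE X A = msum (Lambda_X_star X A) (AGE_lambda X A) \<and>
         (\<forall>\<Lambda>. \<Lambda> \<subset> Lambda_X_star X A \<longrightarrow> SAGE X A \<noteq> msum \<Lambda> (AGE_lambda X A))"
proof -
  interpret polyhedral_signomial_cones X A
    using assms by unfold_locales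
  show ?thesis
    using finite_Lambda_X_star SAGE_eq_reduced_sum[OF assms(6)] SAGE_neq_proper_msum by blast
qed

end
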